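(* There exists a numerical constant $c>0$ such that, for all $n\ge1$ and all strong Muckenhoupt weights $w\in A_\infty^*$ on $\mathbb R^n$, we have $w\in A_p^*$ for all $p\ge e^{c[w]_{A_\infty^*}}$, and $$[w]_{A_p^*}\le e^{e^{cp[w]_{A_\infty^*}}}$$ for all such $p$.
   Context: A weight on $\mathbb R^n$ is a non-negative locally integrable function. For a weight $v$ on $\mathbb R$ write $v(I)=\int_I v$ and define, with suprema over bounded intervals $I\subset\mathbb R$: for $1<p<\infty$, $$[v]_{A_p}=\sup_I\Bigl(\frac1{|I|}\int_I v\Bigr)\Bigl(\frac1{|I|}\int_I v^{-\frac1{p-1}}\Bigr)^{p-1};$$ and $[v]_{A_\infty}=\sup_I\frac1{v(I)}\int_I\mathsf M_1(v\mathbf 1_I)$ (Fujii–Wilson constant), where $\mathsf M_1f(x)=\sup_{I\ni x}\frac1{|I|}\int_I|f|$ is the non-centered Hardy–Littlewood maximal operator on $\mathbb R$. For a weight $w$ on $\mathbb R^n$, $1\le j\le n$ and $\bar x^j=(x_1,\dots,x_{j-1},x_{j+1},\dots,x_n)\in\mathbb R^{n-1}$, let $w_{\bar x^j}(t)=w(x_1,\dots,x_{j-1},t,x_{j+1},\dots,x_n)$, $t\in\mathbb R$. For $1<p\le\infty$ define $[w]_{A_p^*}=\sup_{1\le j\le n}\operatorname{ess\,sup}_{\bar x^j\in\mathbb R^{n-1}}[w_{\bar x^j}]_{A_p}$, and let $A_p^*$ be the class of weights $w$ with $[w]_{A_p^*}<+\infty$. *)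

theory Defs
  imports "HOL-Analysis.Analysis" "HOL-Probability.Essential_Supremum"
begin

section \<open>Muckenhoupt constants on the real line\<close>

text \<open>Bounded intervals of any kind (open, closed, half-open), of positive length.\<close>

definition bdd_intervals :: "real set set" where
  "bdd_intervals = {I. is_interval I \<and> bounded I \<and> 0 < emeasure lebesgue I}"

definition average :: "(real \<Rightarrow> ennreal) \<Rightarrow> real set \<Rightarrow> ennreal" where
  "average f I = (\<integral>\<^sup>+x\<in>I. f x \<partial>lebesgue) / emeasure lebesgue I"

text \<open>Real powers on \<open>[0, \<infinity>]\<close>. Unlike \<open>powr\<close> on the reals, a negative power of \<open>0\<close> is \<open>\<infinity>\<close>.
  So an average of \<open>v powr (- 1 / (p - 1))\<close> is infinite if \<open>v\<close> vanishes on a non-null set.\<close>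

definition epowr :: "ennreal \<Rightarrow> real \<Rightarrow> ennreal" where
  "epowr x a =
    (if a = 0 then 1
     else if x = 0 then (if a < 0 then \<infinity> else 0)
     else if x = \<infinity> then (if a < 0 then 0 else \<infinity>)
     else ennreal (enn2real x powr a))"

definition Ap_const :: "real \<Rightarrow> (real \<Rightarrow> real) \<Rightarrow> ennreal" where
  "Ap_const p v =
    (SUP I\<in>bdd_intervals.
       average (\<lambda>x. ennreal (v x)) I *
       epowr (average (\<lambda>x. epowr (ennreal (v x)) (- 1 / (p - 1))) I) (p - 1))"

definition maximal :: "(real \<Rightarrow> real) \<Rightarrow> real \<Rightarrow> ennreal" where
  "maximal f x = (SUP I\<in>{I \<in> bdd_intervals. x \<in> I}. average (\<lambda>y. ennreal \<bar>f y\<bar>) I)"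

text \<open>The Fujii--Wilson constant. Intervals on which \<open>v\<close> vanishes almost everywhere contribute
  \<open>0 / 0 = 0\<close>, i.e. they are disregarded.\<close>

definition Ainf_const :: "(real \<Rightarrow> real) \<Rightarrow> ennreal" where
  "Ainf_const v =
    (SUP I\<in>bdd_intervals.
       (\<integral>\<^sup>+x\<in>I. maximal (\<lambda>y. v y * indicator I y) x \<partial>lebesgue) /
       (\<integral>\<^sup>+x\<in>I. ennreal (v x) \<partial>lebesgue))"


section \<open>Strong Muckenhoupt weights\<close>

text \<open>The dimension is quantified inside the theorem, so \<open>\<real>\<^sup>n\<close> cannot be a type: its points are the
  extensional functions on \<open>{1..n}\<close>. More generally \<open>lebesgue_PiM J\<close> is Lebesgue measure on \<open>\<real>\<^sup>J\<close>
  for a finite index set \<open>J\<close>; for \<open>J = {}\<close> this is the unit mass on a single point.\<close>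

definition lebesgue_PiM :: "nat set \<Rightarrow> (nat \<Rightarrow> real) measure" where
  "lebesgue_PiM J = completion (\<Pi>\<^sub>M i\<in>J. lborel)"

text \<open>Local integrability is integrability over every cube \<open>[-r, r]\<^sup>n\<close>, as every
  compact set lies in such a cube.\<close>

definition weight :: "nat \<Rightarrow> ((nat \<Rightarrow> real) \<Rightarrow> real) \<Rightarrow> bool" where
  "weight n w \<longleftrightarrow>
    (\<forall>x\<in>space (lebesgue_PiM {1..n}). 0 \<le> w x) \<and>
    (\<forall>r. set_integrable (lebesgue_PiM {1..n}) (\<Pi>\<^sub>E i\<in>{1..n}. {-r..r}) w)"

text \<open>The library's \<open>esssup\<close> is \<open>\<infinity>\<close> for a non-measurable function. This does not happen for
  the two constants above: if \<open>w\<close> is a weight, almost every slice is locally integrable, and then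
  the suprema over intervals may be taken over intervals with rational endpoints.\<close>

definition strong_const ::
    "((real \<Rightarrow> real) \<Rightarrow> ennreal) \<Rightarrow> nat \<Rightarrow> ((nat \<Rightarrow> real) \<Rightarrow> real) \<Rightarrow> ennreal" where
  "strong_const C n w =
    (SUP j\<in>{1..n}. esssup (lebesgue_PiM ({1..n} - {j})) (\<lambda>x. C (\<lambda>t. w (x(j := t)))))"

definition strong_Ap_const :: "real \<Rightarrow> nat \<Rightarrow> ((nat \<Rightarrow> real) \<Rightarrow> real) \<Rightarrow> ennreal" where
  "strong_Ap_const p = strong_const (Ap_const p)"

definition strong_Ainf_const :: "nat \<Rightarrow> ((nat \<Rightarrow> real) \<Rightarrow> real) \<Rightarrow> ennreal" where
  "strong_Ainf_const = strong_const Ainf_const"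

definition strong_Ap :: "real \<Rightarrow> nat \<Rightarrow> ((nat \<Rightarrow> real) \<Rightarrow> real) set" where
  "strong_Ap p n = {w. weight n w \<and> strong_Ap_const p n w < \<infinity>}"

definition strong_Ainf :: "nat \<Rightarrow> ((nat \<Rightarrow> real) \<Rightarrow> real) set" where
  "strong_Ainf n = {w. weight n w \<and> strong_Ainf_const n w < \<infinity>}"

end

theory Submission
  imports Defs
begin


text \<open>
  The theorem is one-dimensional. Almost every slice \<open>v\<close> of \<open>w\<close> is a locally integrable weight on
  the line whose Fujii--Wilson constant is at most \<open>K\<close>, the strong constant of \<open>w\<close>; a bound for
  the \<open>A\<^sub>p\<close> constant of \<open>v\<close> in terms of \<open>K\<close> and \<open>p\<close> only is then a bound for the strong \<open>A\<^sub>p\<close>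
  constant in every dimension. If \<open>K < 1\<close>, almost every slice vanishes almost everywhere
  (\<open>one_le_Ainf_const\<close>), so let \<open>K \<ge> 1\<close>, and write \<open>\<mu>\<close> for the measure with density \<open>v\<close>.

  Both steps of the one-dimensional proof rest on the rising sun lemma. For \<open>f \<ge> 0\<close> and a level \<open>l\<close>
  above the average of \<open>f\<close> over \<open>I\<close>, it provides disjoint open subintervals of \<open>I\<close> on each of which
  the average of \<open>f\<close> is exactly \<open>l\<close>, while \<open>f \<le> l\<close> almost everywhere outside them
  (\<open>calderon_zygmund\<close>). As the averages are equal to \<open>l\<close>, and not merely comparable with \<open>l\<close>,
  nothing is lost in passing from a level to the intervals that belong to it.

  From \<open>A\<^sub>\<infinity>\<close> to the halving property. On the intervals belonging to \<open>f = v\<close> and to the level \<open>l\<close> the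
  maximal function is at least \<open>l\<close>, and \<open>\<mu> {v > l} \<le> l |{M v \<ge> l}|\<close> follows. Summing over the levels
  \<open>2\<^sup>k m\<close>, \<open>k < N\<close>, where \<open>m\<close> is the average of \<open>v\<close> over \<open>I\<close>, bounds \<open>N \<mu> {v > 2\<^sup>N m}\<close> by twice the
  integral of the maximal function, hence by \<open>2 K \<mu>(I)\<close>. With \<open>N \<ge> 8 K\<close> the part of \<open>I\<close> where \<open>v\<close> is
  large carries at most a quarter of the mass, and so a subset of \<open>I\<close> of relative measure at most
  \<open>\<alpha> = 2\<^sup>-\<^sup>N / 4\<close> carries at most half of the mass (\<open>Ainf_imp_halving\<close>).

  From the halving property to \<open>A\<^sub>p\<close>. Now the decomposition is applied to indicator functions at the
  level \<open>1 - \<alpha>\<close>. A set \<open>A\<close> of smaller density is, up to a null set, contained in a set \<open>U\<close>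
  that is larger by the factor \<open>1 / (1 - \<alpha>)\<close> in measure but at most by the factor \<open>2\<close> in mass. By induction
  \<open>|A| \<ge> (1 - \<alpha>)\<^sup>n |I|\<close> implies \<open>\<mu>(I) \<le> 2\<^sup>n \<mu>(A)\<close> (\<open>power_dense_subset_mass\<close>). The set where
  \<open>v < 4\<^sup>-\<^sup>n m\<close> has too little mass for this, so its relative measure is at most \<open>(1 - \<alpha>)\<^sup>n\<close>
  (\<open>sublevel_measure\<close>). Hence \<open>v\<^sup>-\<^sup>s\<close> is integrable for \<open>s \<le> \<alpha> / 4\<close>, and \<open>s = 1 / (p - 1)\<close> gives
  \<open>[v] \<le> (5 / \<alpha>)\<^sup>p\<^sup>-\<^sup>1\<close> (\<open>Ap_const_le_of_small\<close>). As \<open>1 / \<alpha>\<close> is of the order \<open>e\<^sup>O\<^sup>(\<^sup>K\<^sup>)\<close>, this holds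
  for all \<open>p \<ge> e\<^sup>O\<^sup>(\<^sup>K\<^sup>)\<close>; the resulting constant \<open>e\<^sup>O\<^sup>(\<^sup>p\<^sup>K\<^sup>)\<close> is far below the double exponential.

  It remains to see that the \<open>A\<^sub>p\<close> constant of the slice is a measurable function of the line, without
  which the essential supremum would be infinite. For almost every line the slice agrees almost
  everywhere with the slice of a Borel function, and only countably many intervals matter
  (\<open>Ap_const_rational\<close>, \<open>Ap_const_slice_measurable\<close>).
\<close>

section \<open>The rising sun lemma\<close>

lemma bounded_open_connected_real:
  fixes C :: "real set"
  assumes "open C" "connected C" "C \<noteq> {}" "C \<subseteq> {a<..<b}"
  obtains c d where "c < d" "a \<le> c" "d \<le> b" "C = {c<..<d}"
proof -
  have bb: "bdd_below C" "bdd_above C"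
    using assms(4) by (meson bdd_below_mono bdd_below_Ioo, meson bdd_above_mono bdd_above_Ioo)
  have in_C: "x \<in> C" if x: "Inf C < x" "x < Sup C" for x
  proof -
    obtain y where "y \<in> C" "y < x"
      using x(1) cInf_less_iff[OF assms(3) bb(1)] by blast
    moreover obtain z where "z \<in> C" "x < z"
      using x(2) less_cSup_iff[OF assms(3) bb(2)] by blast
    ultimately show ?thesis
      using connectedD_interval[OF assms(2), of y z x] by simp
  qed
  have lt: "Inf C < x" "x < Sup C" if x: "x \<in> C" for x
  proof -
    obtain e where e: "e > 0" "ball x e \<subseteq> C"
      using assms(1) x openE by blast
    have "x - e/2 \<in> C" "x + e/2 \<in> C"
      using e by (auto simp: subset_iff dist_real_def)
    then show "Inf C < x" "x < Sup C"
      using cInf_lower[OF _ bb(1)] cSup_upper[OF _ bb(2)] e(1) by force+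
  qed
  have eq: "C = {Inf C<..<Sup C}"
    using in_C lt by auto
  have "Inf C < Sup C"
    using lt assms(3) by force
  moreover have "a \<le> Inf C" "Sup C \<le> b"
    using assms(4) by (intro cInf_greatest cSup_least assms(3); force)+
  ultimately show thesis
    using that eq by blast
qed

text \<open>
  A point belongs to \<open>S\<close> if some later point is higher than the point itself or higher than the left
  endpoint; with the first alternative only, this is the classical rising sun lemma. There a component
  starting at \<open>a\<close> only satisfies \<open>F a \<le> F d\<close>. The second alternative extends such a component to a
  point where \<open>F\<close> has come down to \<open>F a\<close> for good, so that equality holds for it as well.
\<close>

lemma rising_sun:
  fixes F :: "real \<Rightarrow> real"
  assumes cont: "continuous_on {a..b} F" and "F b \<le> F a"
  defines "S \<equiv> {x \<in> {a<..<b}. \<exists>y\<in>{x<..b}. min (F x) (F a) < F y}"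
  shows rising_sun_open: "open S"
    and rising_sun_component: "C \<in> components S \<Longrightarrow>
      \<exists>c d. c < d \<and> a \<le> c \<and> d \<le> b \<and> C = {c<..<d} \<and> F c = F d"
proof -
  define H where "H x = min (F x) (F a)" for x
  have contH: "continuous_on {a..b} H"
    unfolding H_def using cont by (intro continuous_intros)
  have S_eq: "S = (\<Union>y\<in>{a..b}. {a<..<y} \<inter> H -` {..<F y})"
  proof (intro equalityI subsetI)
    fix x assume "x \<in> S"
    then obtain y where "a < x" "x < y" "y \<le> b" "H x < F y"
      by (auto simp: S_def H_def)
    then show "x \<in> (\<Union>y\<in>{a..b}. {a<..<y} \<inter> H -` {..<F y})"
      by (intro UN_I[of y]) auto
  qed (auto simp: S_def H_def)
  show "open S"
    unfolding S_eq
  proof (intro open_UN ballI)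
    fix y assume "y \<in> {a..b}"
    then have "continuous_on {a<..<y} H"
      by (auto intro: continuous_on_subset[OF contH])
    then show "open ({a<..<y} \<inter> H -` {..<F y})"
      by (intro continuous_open_preimage) auto
  qed
  assume C: "C \<in> components S"
  have "C \<subseteq> S" "connected C" "C \<noteq> {}" "open C"
    using in_components_subset[OF C] in_components_connected[OF C] in_components_nonempty[OF C]
      open_components[OF \<open>open S\<close> C] by auto
  moreover have "S \<subseteq> {a<..<b}"
    by (auto simp: S_def)
  ultimately have "C \<subseteq> {a<..<b}"
    by blast
  obtain c d where cd: "c < d" "a \<le> c" "d \<le> b" "C = {c<..<d}"
    using bounded_open_connected_real[OF \<open>open C\<close> \<open>connected C\<close> \<open>C \<noteq> {}\<close> \<open>C \<subseteq> {a<..<b}\<close>] by blast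
  have right_limit: "F x \<le> k" if "a \<le> x" "x < b" "\<And>y. x < y \<Longrightarrow> y \<le> b \<Longrightarrow> F y \<le> k" for x k
  proof (rule continuous_le_on_closure[where S="{x<..b}" and f=F])
    show "continuous_on (closure {x<..b}) F"
      using that by (auto intro: continuous_on_subset[OF cont])
  qed (use that in auto)
  have c: "c \<notin> S"
  proof
    assume "c \<in> S"
    then have "{c..<d} \<subseteq> S"
      using \<open>C \<subseteq> S\<close> cd by force
    moreover have "C \<inter> {c..<d} \<noteq> {}"
      using cd dense[of c d] by auto
    ultimately have "{c..<d} \<subseteq> C"
      using components_maximal[OF C] by (meson connected_Ico)
    then show False
      using cd by auto
  qed
  have d: "d \<notin> S"
  proof
    assume "d \<in> S"
    then have "{c<..d} \<subseteq> S"
      using \<open>C \<subseteq> S\<close> cd by force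
    moreover have "C \<inter> {c<..d} \<noteq> {}"
      using cd dense[of c d] by auto
    ultimately have "{c<..d} \<subseteq> C"
      using components_maximal[OF C] by (meson connected_Ioc)
    then show False
      using cd by auto
  qed
  have c_bound: "F y \<le> min (F c) (F a)" if "a < c" "c < y" "y \<le> b" for y
    using c that cd by (force simp: S_def not_less)
  have d_bound: "F y \<le> min (F d) (F a)" if "d < y" "y \<le> b" for y
    using d that cd by (force simp: S_def not_less)
  have "F d \<le> F c"
  proof (cases "a < c")
    case True
    then show ?thesis using c_bound cd by auto
  next
    case False
    then have "c = a" using cd by auto
    show ?thesis
    proof (cases "d = b")
      case True
      then show ?thesis using assms \<open>c = a\<close> by simp
    next
      case False
      then show ?thesis
        unfolding \<open>c = a\<close> using right_limit[of d "F a"] cd d_bound by auto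
    qed
  qed
  moreover have "F c \<le> F d"
  proof -
    have H_le: "H x \<le> F d" if x: "c < x" "x < d" for x
    proof (rule ccontr)
      assume "\<not> H x \<le> F d"
      then have lt: "F d < H x" by simp
      have "continuous_on {x..d} H"
        using x cd by (auto intro: continuous_on_subset[OF contH])
      then have "closed ({x..d} \<inter> H -` {H x..})"
        by (intro continuous_closed_preimage) auto
      then have "compact ({x..d} \<inter> H -` {H x..})"
        by (simp add: compact_eq_bounded_closed bounded_Int)
      moreover have "x \<in> {x..d} \<inter> H -` {H x..}"
        using x by auto
      \<comment> \<open>\<open>z\<close> is the last point up to \<open>d\<close> where \<open>H\<close> is at least as high as at \<open>x\<close>; as a point of \<open>S\<close>
        it is exceeded later, necessarily after \<open>d\<close>, which would put \<open>d\<close> into \<open>S\<close>\<close>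
      ultimately obtain z where "z \<in> {x..d} \<inter> H -` {H x..}"
        and "\<forall>t\<in>{x..d} \<inter> H -` {H x..}. t \<le> z"
        using compact_attains_sup[of "{x..d} \<inter> H -` {H x..}"] by blast
      then have z: "x \<le> z" "z \<le> d" "H x \<le> H z"
        and last: "\<And>t. x \<le> t \<Longrightarrow> t \<le> d \<Longrightarrow> H x \<le> H t \<Longrightarrow> t \<le> z"
        by auto
      have "H d < H x"
        using lt by (auto simp: H_def)
      then have "z \<noteq> d" using z by auto
      then have "z \<in> C" using z x cd by auto
      then have "z \<in> S" using \<open>C \<subseteq> S\<close> by blast
      then have "\<exists>y\<in>{z<..b}. H z < F y" by (simp add: S_def H_def)
      then obtain y where y: "z < y" "y \<le> b" "H z < F y" by auto
      have "H x \<le> H y"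
        using y z by (auto simp: H_def)
      with last[of y] y z have "d < y" by force
      then show False
        using d_bound[of y] y z lt by auto
    qed
    have "H c \<le> F d"
    proof (rule continuous_le_on_closure[where S="{c<..<d}" and f=H])
      show "continuous_on (closure {c<..<d}) H"
        using cd by (auto intro: continuous_on_subset[OF contH])
      show "c \<in> closure {c<..<d}"
        using cd by auto
      show "H x \<le> F d" if "x \<in> {c<..<d}" for x
        using H_le that by auto
    qed
    moreover have "F c \<le> F a"
    proof (cases "a < c")
      case True
      then show ?thesis
        using right_limit[of c "F a"] cd c_bound by auto
    next
      case False
      then show ?thesis using cd by simp
    qed
    ultimately show ?thesis by (simp add: H_def)
  qed
  ultimately show "\<exists>c d. c < d \<and> a \<le> c \<and> d \<le> b \<and> C = {c<..<d} \<and> F c = F d"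
    using cd by (intro exI[of _ c] exI[of _ d]) auto
qed

section \<open>Intervals of prescribed average\<close>

lemma set_nn_integral_lebesgue_integral:
  fixes g :: "real \<Rightarrow> real"
  assumes "g integrable_on A" "\<And>x. 0 \<le> g x" 
  shows "(\<integral>\<^sup>+x\<in>A. ennreal (g x) \<partial>lebesgue) = ennreal (integral A g)"
proof -
  have "((\<lambda>x. if x \<in> A then g x else 0) has_integral integral A g) UNIV"
    using assms(1) by (simp add: has_integral_restrict_UNIV integrable_integral)
  then have "(\<integral>\<^sup>+x. ennreal (if x \<in> A then g x else 0) \<partial>lebesgue) = ennreal (integral A g)"
    using assms(2) by (subst (asm) has_integral_iff_nn_integral_lebesgue) auto
  moreover have "(\<integral>\<^sup>+x\<in>A. ennreal (g x) \<partial>lebesgue) = (\<integral>\<^sup>+x. ennreal (if x \<in> A then g x else 0) \<partial>lebesgue)"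
    by (rule nn_integral_cong) (auto split: split_indicator)
  ultimately show ?thesis by simp
qed

lemma set_integrable_lebesgue_finite:
  fixes f :: "real \<Rightarrow> real"
  assumes [measurable]: "f \<in> borel_measurable lebesgue" "A \<in> sets lebesgue"
    and "\<And>x. 0 \<le> f x" "(\<integral>\<^sup>+x\<in>A. ennreal (f x) \<partial>lebesgue) < \<infinity>"
  shows "f integrable_on A"
proof -
  have "(\<integral>\<^sup>+x. ennreal (f x * indicator A x) \<partial>lebesgue) < \<infinity>"
    using assms(4) by (simp add: nn_integral_set_ennreal)
  then obtain r where "(\<integral>\<^sup>+x. ennreal (f x * indicator A x) \<partial>lebesgue) = ennreal r" "0 \<le> r"
    by (metis ennreal_cases order.strict_iff_not top.extremum infinity_ennreal_def)
  then have "((\<lambda>x. f x * indicator A x) has_integral r) UNIV"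
    using assms(3) by (subst has_integral_iff_nn_integral_lebesgue) auto
  moreover have "(\<lambda>x. f x * indicator A x) = (\<lambda>x. if x \<in> A then f x else 0)"
    by auto
  ultimately show ?thesis
    using has_integral_restrict_UNIV[of A f r] by (auto simp: integrable_on_def)
qed

text \<open>
  The intervals are the components of the rising sun set of the function
  \<open>F x = \<integral>\<^sub>a\<^sup>x f - l (x - a)\<close>: equality of \<open>F\<close> at the endpoints of a component says that \<open>f\<close> has average
  \<open>l\<close> there. Outside the set \<open>F\<close> cannot increase to the right, and so \<open>f \<le> l\<close> at every point where
  the right derivative of the indefinite integral is \<open>f\<close>.
\<close>

lemma calderon_zygmund:
  fixes f :: "real \<Rightarrow> real"
  assumes meas[measurable]: "f \<in> borel_measurable lebesgue" and nonneg: "\<And>x. 0 \<le> f x"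
    and ab: "a < b" and l: "0 \<le> l"
    and avg: "(\<integral>\<^sup>+x\<in>{a..b}. ennreal (f x) \<partial>lebesgue) \<le> ennreal l * emeasure lebesgue {a..b}"
  obtains D where "countable D" "disjoint D"
    "\<And>J. J \<in> D \<Longrightarrow> \<exists>c d. c < d \<and> a \<le> c \<and> d \<le> b \<and> J = {c<..<d}"
    "\<And>J. J \<in> D \<Longrightarrow> (\<integral>\<^sup>+x\<in>J. ennreal (f x) \<partial>lebesgue) = ennreal l * emeasure lebesgue J"
    "AE x in lebesgue. x \<in> {a..b} - \<Union>D \<longrightarrow> f x \<le> l"
proof -
  define g where "g x = (if x \<in> {a..b} then f x else 0)" for x
  define F where "F x = integral {a..x} f - l * (x - a)" for x
  have avg': "(\<integral>\<^sup>+x\<in>{a..b}. ennreal (f x) \<partial>lebesgue) \<le> ennreal (l * (b - a))"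
    using avg ab l by (simp add: ennreal_mult)
  have int: "f integrable_on {a..b}"
    using avg' by (intro set_integrable_lebesgue_finite nonneg) (auto intro: le_less_trans)
  have "ennreal (integral {a..b} f) \<le> ennreal (l * (b - a))"
    using avg' set_nn_integral_lebesgue_integral[OF int nonneg] by simp
  then have Fba: "F b \<le> F a"
    using l ab by (simp add: F_def)
  have contF: "continuous_on {a..b} F"
    unfolding F_def by (intro continuous_intros indefinite_integral_continuous_1 int)
  have diff: "F y - F x = integral {x..y} f - l * (y - x)" if "a \<le> x" "x \<le> y" "y \<le> b" for x y
  proof -
    have "f integrable_on {a..y}"
      using that int by (auto intro: integrable_on_subinterval)
    then have "integral {a..x} f + integral {x..y} f = integral {a..y} f"
      using that by (intro Henstock_Kurzweil_Integration.integral_combine) auto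
    then show ?thesis
      by (simp add: F_def algebra_simps)
  qed
  define S where "S = {x \<in> {a<..<b}. \<exists>y\<in>{x<..b}. min (F x) (F a) < F y}"
  have comp: "\<exists>c d. c < d \<and> a \<le> c \<and> d \<le> b \<and> J = {c<..<d} \<and> F c = F d" if "J \<in> components S" for J
    using rising_sun_component[OF contF Fba] that unfolding S_def by blast
  show thesis
  proof (rule that[of "components S"])
    show "disjoint (components S)"
      using pairwise_disjoint_components[of S] by (auto simp: pairwise_def disjnt_def)
    have "open J" if "J \<in> components S" for J
      using comp[OF that] by auto
    then show "countable (components S)"
      using pairwise_disjoint_components[of S]
      by (intro countable_disjoint_open_subsets) (auto simp: pairwise_def disjnt_def)
    show "\<exists>c d. c < d \<and> a \<le> c \<and> d \<le> b \<and> J = {c<..<d}" if "J \<in> components S" for J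
      using comp[OF that] by blast
    show "(\<integral>\<^sup>+x\<in>J. ennreal (f x) \<partial>lebesgue) = ennreal l * emeasure lebesgue J"
      if J: "J \<in> components S" for J
    proof -
      obtain c d where cd: "c < d" "a \<le> c" "d \<le> b" "J = {c<..<d}" "F c = F d"
        using comp[OF J] by blast
      have "f integrable_on {c..d}"
        using cd int by (auto intro: integrable_on_subinterval)
      then have "(\<integral>\<^sup>+x\<in>J. ennreal (f x) \<partial>lebesgue) = ennreal (integral {c<..<d} f)"
        unfolding cd(4) by (intro set_nn_integral_lebesgue_integral nonneg) (simp add: integrable_on_Icc_iff_Ioo)
      also have "integral {c<..<d} f = l * (d - c)"
        using diff[of c d] cd by (simp add: integral_open_interval_real)
      finally show ?thesis
        using cd l by (simp add: ennreal_mult)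
    qed
    have "\<exists>N. negligible N \<and> (\<forall>x e. x \<notin> N \<longrightarrow> 0 < e \<longrightarrow>
       (\<exists>d>0. \<forall>h. 0 < h \<and> h < d \<longrightarrow> norm (integral (cbox x (x + h *\<^sub>R One)) g /\<^sub>R h ^ DIM(real) - g x) < e))"
    proof (rule integrable_ccontinuous_explicit)
      fix u v :: real
      have "g integrable_on UNIV"
        unfolding g_def[abs_def] integrable_restrict_UNIV by (rule int)
      then show "g integrable_on cbox u v"
        by (rule integrable_on_subcbox) auto
    qed blast
    then obtain N where N: "negligible N" and deriv: "\<And>x e. x \<notin> N \<Longrightarrow> 0 < e \<Longrightarrow>
       \<exists>d>0. \<forall>h. 0 < h \<and> h < d \<longrightarrow> \<bar>integral {x..x + h} g / h - g x\<bar> < e"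
      by (auto simp: divide_inverse_commute)
    have "x \<in> N \<union> {a, b}" if x: "x \<in> {a..b} - \<Union>(components S)" and gt: "l < f x" for x
    proof (rule ccontr)
      assume nx: "x \<notin> N \<union> {a, b}"
      then have ax: "a < x" "x < b" and "x \<notin> S"
        using x by (auto simp: Union_components[symmetric])
      obtain d where d: "0 < d" "\<And>h. 0 < h \<Longrightarrow> h < d \<Longrightarrow> \<bar>integral {x..x + h} g / h - g x\<bar> < f x - l"
        using deriv[of x "f x - l"] nx gt by auto
      define h where "h = min (d / 2) (b - x)"
      have h: "0 < h" "h < d" "x + h \<le> b"
        using d ax by (auto simp: h_def)
      have "integral {x..x + h} g = integral {x..x + h} f"
        using ax h by (intro Henstock_Kurzweil_Integration.integral_cong) (auto simp: g_def)
      moreover have "g x = f x"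
        using ax by (simp add: g_def)
      ultimately have "l < integral {x..x + h} f / h"
        using d(2)[OF h(1,2)] by (auto simp: abs_less_iff)
      then have "l * h < integral {x..x + h} f"
        using h by (simp add: field_simps)
      then have "F x < F (x + h)"
        using diff[of x "x + h"] ax h by simp
      then have "x \<in> S"
        using ax h unfolding S_def by (auto intro!: bexI[of _ "x + h"])
      then show False using \<open>x \<notin> S\<close> by simp
    qed
    then have "{x. \<not> (x \<in> {a..b} - \<Union>(components S) \<longrightarrow> f x \<le> l)} \<subseteq> N \<union> {a, b}"
      by (auto simp: not_le)
    moreover have "N \<union> {a, b} \<in> null_sets lebesgue"
      using N by (simp add: negligible_iff_null_sets[symmetric] negligible_Un)
    ultimately show "AE x in lebesgue. x \<in> {a..b} - \<Union>(components S) \<longrightarrow> f x \<le> l"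
      by (intro AE_I'[where N="N \<union> {a, b}"]) auto
  qed
qed

text \<open>
  Transfers an inequality from the single intervals of a decomposition to their union. The sets \<open>A\<close>
  and \<open>B\<close> allow to compare, for instance, the mass of the intervals with the mass of a part of them.
\<close>

lemma emeasure_Union_le:
  assumes D: "countable D" "disjoint D" and DM: "D \<subseteq> sets M" and sets: "sets N = sets M"
    and A: "A \<in> sets M" and B: "B \<in> sets M"
    and le: "\<And>J. J \<in> D \<Longrightarrow> emeasure M (A \<inter> J) \<le> k * emeasure N (B \<inter> J)"
  shows "emeasure M (A \<inter> \<Union>D) \<le> k * emeasure N (B \<inter> \<Union>D)"
proof -
  have disj: "disjoint_family_on (\<lambda>J. E \<inter> J) D" for E
    using D(2) by (auto simp: disjoint_family_on_def disjoint_def)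
  have U: "E \<inter> \<Union>D = \<Union>((\<lambda>J. E \<inter> J) ` D)" for E
    by auto
  have "emeasure M (A \<inter> \<Union>D) = (\<integral>\<^sup>+J. emeasure M (A \<inter> J) \<partial>count_space D)"
    unfolding U using DM A by (intro emeasure_UN_countable D disj) auto
  also have "\<dots> \<le> (\<integral>\<^sup>+J. k * emeasure N (B \<inter> J) \<partial>count_space D)"
    using le by (intro nn_integral_mono) auto
  also have "\<dots> = k * (\<integral>\<^sup>+J. emeasure N (B \<inter> J) \<partial>count_space D)"
    by (intro nn_integral_cmult) auto
  also have "(\<integral>\<^sup>+J. emeasure N (B \<inter> J) \<partial>count_space D) = emeasure N (B \<inter> \<Union>D)"
    unfolding U using DM B sets by (intro emeasure_UN_countable[symmetric] D disj) auto
  finally show ?thesis .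
qed

section \<open>From the Fujii--Wilson condition to the halving property\<close>

lemma Icc_sets_lebesgue [simp, measurable]: "{a..b :: real} \<in> sets lebesgue"
  by (intro sets_completionI_sets) simp

text \<open>
  The properties shared by almost all slices of a weight on \<open>\<real>\<^sup>n\<close>.
\<close>

locale line_weight =
  fixes v :: "real \<Rightarrow> real"
  assumes meas[measurable]: "v \<in> borel_measurable lebesgue"
    and nonneg: "0 \<le> v x"
    and loc_int: "(\<integral>\<^sup>+x\<in>{a..b}. ennreal (v x) \<partial>lebesgue) < \<infinity>"
begin

definition \<mu> :: "real measure" where
  "\<mu> = density lebesgue (\<lambda>x. ennreal (v x))"

lemma sets_\<mu>[measurable_cong, simp]: "sets \<mu> = sets lebesgue"
  and space_\<mu>[simp]: "space \<mu> = UNIV"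
  by (auto simp: \<mu>_def)

lemma emeasure_\<mu>:
  "A \<in> sets lebesgue \<Longrightarrow> emeasure \<mu> A = (\<integral>\<^sup>+x\<in>A. ennreal (v x) \<partial>lebesgue)"
  unfolding \<mu>_def by (rule emeasure_density) auto

lemma emeasure_\<mu>_finite: "emeasure \<mu> {a..b} < \<infinity>"
  using loc_int by (simp add: emeasure_\<mu>)

lemma AE_\<mu>: "AE x in lebesgue. P x \<Longrightarrow> AE x in \<mu>. P x"
  unfolding \<mu>_def by (subst AE_density) auto

text \<open>
  A quantitative form of the \<open>A\<^sub>\<infinity>\<close> condition in terms of sets, which makes no reference to the maximal
  function. It links the Fujii--Wilson constant with the \<open>A\<^sub>p\<close> constants.
\<close>

definition halving :: "real \<Rightarrow> bool" where
  "halving \<alpha> \<longleftrightarrow> (\<forall>a b A. a < b \<longrightarrow> A \<in> sets lebesgue \<longrightarrow> A \<subseteq> {a..b} \<longrightarrow>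
     emeasure lebesgue A \<le> ennreal (\<alpha> * (b - a)) \<longrightarrow> emeasure \<mu> A \<le> emeasure \<mu> {a..b} / 2)"

lemma halvingD:
  assumes "halving \<alpha>" "a < b" "A \<in> sets lebesgue" "A \<subseteq> {a..b}"
    and "emeasure lebesgue A \<le> ennreal (\<alpha> * (b - a))"
  shows "emeasure \<mu> A \<le> emeasure \<mu> {a..b} / 2"
  using assms unfolding halving_def by blast

lemma Ainf_const_integral_maximal:
  assumes K: "Ainf_const v \<le> ennreal K" and ab: "a < b"
    and V: "emeasure \<mu> {a..b} = ennreal V" "0 < V"
  shows "(\<integral>\<^sup>+x\<in>{a..b}. maximal (\<lambda>y. v y * indicator {a..b} y) x \<partial>lebesgue) \<le> ennreal K * ennreal V"
    (is "?X \<le> _")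
proof -
  have "{a..b} \<in> bdd_intervals"
    using ab by (auto simp: bdd_intervals_def is_interval_cc)
  then have "?X / (\<integral>\<^sup>+x\<in>{a..b}. ennreal (v x) \<partial>lebesgue) \<le> Ainf_const v"
    unfolding Ainf_const_def by (rule SUP_upper)
  then have "?X / ennreal V \<le> ennreal K"
    using K V by (simp add: emeasure_\<mu>)
  then have "?X / ennreal V * ennreal V \<le> ennreal K * ennreal V"
    by (rule mult_right_mono) simp
  moreover have "?X / ennreal V * ennreal V = ?X"
    using V(2) by (simp add: ennreal_divide_times ennreal_times_divide ennreal_mult_divide_eq)
  ultimately show ?thesis by simp
qed

text \<open>
  The inequality \<open>l |{M v \<ge> l}| \<ge> \<mu> {v > l}\<close>, summed over the levels \<open>l = 2\<^sup>k m\<close> with \<open>k < N\<close>. Every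
  summand on the right is at least the mass of the highest tail. This takes the place of the usual
  integration over all levels, which bounds the integral of \<open>v log v\<close> by that of the maximal function.
  The integral of the maximal function is estimated from below by that of a simple function.
\<close>

lemma Ainf_mass_tail:
  assumes K: "Ainf_const v \<le> ennreal K" "0 \<le> K" and ab: "a < b"
    and m: "emeasure \<mu> {a..b} = ennreal (m * (b - a))" "0 < m"
  shows "ennreal N * emeasure \<mu> {x \<in> {a..b}. 2 ^ N * m < v x} \<le> ennreal (2 * K * (m * (b - a)))"
proof -
  let ?I = "{a..b}"
  let ?M = "maximal (\<lambda>y. v y * indicator ?I y)"
  let ?T = "{x \<in> ?I. 2 ^ N * m < v x}"
  \<comment> \<open>a predicate, as \<open>D\<close> has to be chosen for all levels at once\<close>
  define CZ where "CZ k D \<longleftrightarrow> countable D \<and> disjoint D \<and>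
      (\<forall>J\<in>D. \<exists>c d. c < d \<and> a \<le> c \<and> d \<le> b \<and> J = {c<..<d}) \<and>
      (\<forall>J\<in>D. (\<integral>\<^sup>+x\<in>J. ennreal (v x) \<partial>lebesgue) = ennreal (2 ^ k * m) * emeasure lebesgue J) \<and>
      (AE x in lebesgue. x \<in> ?I - \<Union>D \<longrightarrow> v x \<le> 2 ^ k * m)" for k :: nat and D
  have "\<exists>D. CZ k D" for k
  proof -
    have "1 * (m * (b - a)) \<le> 2 ^ k * (m * (b - a))"
      using m(2) ab by (intro mult_right_mono) auto
    then have "(\<integral>\<^sup>+x\<in>?I. ennreal (v x) \<partial>lebesgue) \<le> ennreal (2 ^ k * m) * emeasure lebesgue ?I"
      using m ab by (simp add: emeasure_\<mu>[symmetric] ennreal_mult[symmetric] mult.assoc del: ennreal_le_iff)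
         (auto intro: ennreal_leI)
    moreover have "0 \<le> 2 ^ k * m"
      using m by simp
    ultimately show ?thesis
      unfolding CZ_def by (rule_tac calderon_zygmund[OF meas nonneg ab]) blast+
  qed
  then obtain D where CZ_D: "\<And>k. CZ k (D k)"
    by metis
  then have D: "\<And>k. countable (D k)" "\<And>k. disjoint (D k)"
    and int: "\<And>k J. J \<in> D k \<Longrightarrow> \<exists>c d. c < d \<and> a \<le> c \<and> d \<le> b \<and> J = {c<..<d}"
    and eq: "\<And>k J. J \<in> D k \<Longrightarrow> (\<integral>\<^sup>+x\<in>J. ennreal (v x) \<partial>lebesgue) = ennreal (2 ^ k * m) * emeasure lebesgue J"
    and off: "\<And>k. AE x in lebesgue. x \<in> ?I - \<Union>(D k) \<longrightarrow> v x \<le> 2 ^ k * m"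
    unfolding CZ_def by simp_all
  define U where "U k = \<Union>(D k)" for k
  have openU: "open (U k)" for k
    unfolding U_def using int by (force intro: open_Union)
  then have Um[measurable]: "U k \<in> sets lebesgue" for k
    by (simp add: borel_open)
  have U_sub: "U k \<subseteq> ?I" for k
    unfolding U_def using int by force
  have max_ge: "ennreal (2 ^ k * m) \<le> ?M x" if x: "x \<in> U k" for x k
  proof -
    obtain J where J: "J \<in> D k" "x \<in> J"
      using x by (auto simp: U_def)
    obtain c d where cd: "c < d" "a \<le> c" "d \<le> b" "J = {c<..<d}"
      using int[OF J(1)] by auto
    have "average (\<lambda>y. ennreal \<bar>v y * indicator ?I y\<bar>) J
        = (\<integral>\<^sup>+x\<in>J. ennreal (v x) \<partial>lebesgue) / emeasure lebesgue J"
      unfolding average_def using cd nonneg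
      by (intro arg_cong2[where f="(/)"] nn_integral_cong) (auto split: split_indicator)
    also have "\<dots> = ennreal (2 ^ k * m)"
      unfolding eq[OF J(1)] using cd by (intro ennreal_mult_divide_eq) auto
    finally have "ennreal (2 ^ k * m) = average (\<lambda>y. ennreal \<bar>v y * indicator ?I y\<bar>) J" ..
    moreover have "J \<in> bdd_intervals"
      using cd by (auto simp: bdd_intervals_def is_interval_oo)
    ultimately show ?thesis
      unfolding maximal_def using J(2) by (auto intro!: SUP_upper)
  qed
  have mass_U: "emeasure \<mu> (U k) \<le> ennreal (2 ^ k * m) * emeasure lebesgue (U k)" for k
  proof -
    have "emeasure \<mu> (UNIV \<inter> \<Union>(D k)) \<le> ennreal (2 ^ k * m) * emeasure lebesgue (UNIV \<inter> \<Union>(D k))"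
    proof (rule emeasure_Union_le[OF D])
      show DM: "D k \<subseteq> sets \<mu>"
        using int by fastforce
      show "emeasure \<mu> (UNIV \<inter> J) \<le> ennreal (2 ^ k * m) * emeasure lebesgue (UNIV \<inter> J)"
        if "J \<in> D k" for J
        using eq[OF that] DM that by (auto simp: emeasure_\<mu>)
    qed auto
    then show ?thesis by (simp add: U_def)
  qed
  have T: "emeasure \<mu> ?T \<le> emeasure \<mu> (U k)" if k: "k < N" for k
  proof (rule emeasure_mono_AE)
    have le: "2 ^ k * m \<le> 2 ^ N * m"
      using k m by (intro mult_right_mono power_increasing) auto
    then have "AE x in lebesgue. x \<in> ?T \<longrightarrow> x \<in> U k"
      using off[of k] by eventually_elim (use le in \<open>auto simp: U_def\<close>)
    then show "AE x in \<mu>. x \<in> ?T \<longrightarrow> x \<in> U k"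
      by (rule AE_\<mu>)
  qed simp
  \<comment> \<open>the levels form a geometric progression, so their sum is at most twice the highest level met\<close>
  have sum_le: "(\<Sum>k<n. ennreal (2 ^ k * m / 2) * indicator (U k) x) \<le> ?M x * indicator ?I x" for n x
  proof (induction n)
    case (Suc n)
    show ?case
    proof (cases "x \<in> U n")
      case True
      have "(\<Sum>k<Suc n. ennreal (2 ^ k * m / 2) * indicator (U k) x) \<le> (\<Sum>k<Suc n. ennreal (2 ^ k * m / 2))"
        by (intro sum_mono) (auto split: split_indicator)
      also have "\<dots> = ennreal (\<Sum>k<Suc n. 2 ^ k * m / 2)"
        using m(2) by (intro sum_ennreal) auto
      also have "(\<Sum>k<Suc n. 2 ^ k * m / 2) = (\<Sum>k<Suc n. 2 ^ k) * (m / 2)"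
        by (simp add: sum_distrib_right del: sum.lessThan_Suc)
      also have "\<dots> = (2 ^ Suc n - 1) * (m / 2)"
        by (subst sum_gp_strict) simp
      also have "\<dots> \<le> 2 ^ n * m"
        using m(2) by (simp add: algebra_simps)
      also have "ennreal (2 ^ n * m) \<le> ?M x"
        by (rule max_ge[OF True])
      finally have "(\<Sum>k<Suc n. ennreal (2 ^ k * m / 2) * indicator (U k) x) \<le> ?M x"
        by (simp add: ennreal_leI del: sum.lessThan_Suc)
      moreover have "x \<in> ?I"
        using True U_sub by blast
      ultimately show ?thesis
        by (simp del: sum.lessThan_Suc)
    next
      case False
      then show ?thesis using Suc by simp
    qed
  qed simp
  have V: "emeasure \<mu> ?I = ennreal (m * (b - a))" "0 < m * (b - a)"
    using m ab by auto
  have "ennreal (N / 2) * emeasure \<mu> ?T = (\<Sum>k<N. emeasure \<mu> ?T / 2)"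
    by (simp add: ennreal_of_nat_eq_real_of_nat ennreal_divide_numeral[symmetric] divide_ennreal_def mult_ac)
  also have "\<dots> \<le> (\<Sum>k<N. emeasure \<mu> (U k) / 2)"
    using T by (intro sum_mono divide_right_mono_ennreal) auto
  also have "\<dots> \<le> (\<Sum>k<N. ennreal (2 ^ k * m / 2) * emeasure lebesgue (U k))"
  proof (intro sum_mono)
    fix k
    have "emeasure \<mu> (U k) / 2 \<le> ennreal (2 ^ k * m) * emeasure lebesgue (U k) / 2"
      by (intro divide_right_mono_ennreal mass_U)
    also have "\<dots> = ennreal (2 ^ k * m / 2) * emeasure lebesgue (U k)"
      using m(2) by (simp add: ennreal_divide_numeral[symmetric] divide_ennreal_def mult_ac)
    finally show "emeasure \<mu> (U k) / 2 \<le> ennreal (2 ^ k * m / 2) * emeasure lebesgue (U k)" .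
  qed
  also have "\<dots> = (\<integral>\<^sup>+x. (\<Sum>k<N. ennreal (2 ^ k * m / 2) * indicator (U k) x) \<partial>lebesgue)"
    by (subst nn_integral_sum) (auto simp: nn_integral_cmult_indicator)
  also have "\<dots> \<le> (\<integral>\<^sup>+x\<in>?I. ?M x \<partial>lebesgue)"
    by (intro nn_integral_mono sum_le)
  also have "\<dots> \<le> ennreal K * ennreal (m * (b - a))"
    by (rule Ainf_const_integral_maximal[OF K(1) ab V])
  finally have "2 * (ennreal (N / 2) * emeasure \<mu> ?T) \<le> 2 * (ennreal K * ennreal (m * (b - a)))"
    by (rule mult_left_mono) simp
  moreover have "2 * (ennreal (N / 2) * emeasure \<mu> ?T) = ennreal N * emeasure \<mu> ?T"
    by (simp add: ennreal_mult[symmetric] mult.assoc[symmetric] ennreal_numeral[symmetric] del: ennreal_numeral)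
  moreover have "2 * (ennreal K * ennreal (m * (b - a))) = ennreal (2 * K * (m * (b - a)))"
    using K V by (simp add: ennreal_mult mult.assoc)
  ultimately show ?thesis by simp
qed

text \<open>
  The set \<open>A\<close> is split according to whether \<open>v\<close> exceeds \<open>2\<^sup>N m\<close>. The part where it does has mass at
  most \<open>2 K \<mu>(I) / N \<le> \<mu>(I) / 4\<close>; on the other part the mass is at most \<open>2\<^sup>N m |A| \<le> \<mu>(I) / 4\<close>.
\<close>

lemma Ainf_imp_halving:
  assumes K: "Ainf_const v \<le> ennreal K" "0 < K" and N: "8 * K \<le> real N"
  shows "halving ((1 / 2) ^ N / 4)"
  unfolding halving_def
proof (intro allI impI)
  fix a b :: real and A
  assume ab: "a < b" and A[measurable]: "A \<in> sets lebesgue" "A \<subseteq> {a..b}"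
    and small: "emeasure lebesgue A \<le> ennreal ((1 / 2) ^ N / 4 * (b - a))"
  obtain V where V: "emeasure \<mu> {a..b} = ennreal V" "0 \<le> V"
    using emeasure_\<mu>_finite[of a b] by (cases "emeasure \<mu> {a..b}") auto
  show "emeasure \<mu> A \<le> emeasure \<mu> {a..b} / 2"
  proof (cases "V = 0")
    case True
    then have "emeasure \<mu> A \<le> 0"
      using emeasure_mono[of A "{a..b}" \<mu>] A V by simp
    then show ?thesis by simp
  next
    case False
    define m where "m = V / (b - a)"
    have m: "emeasure \<mu> {a..b} = ennreal (m * (b - a))" "0 < m"
      using V False ab by (auto simp: m_def)
    define T where "T = {x \<in> {a..b}. 2 ^ N * m < v x}"
    have [measurable]: "T \<in> sets lebesgue"
      unfolding T_def by measurable
    have "emeasure \<mu> T \<le> emeasure \<mu> {a..b}"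
      by (rule emeasure_mono) (auto simp: T_def)
    then obtain t where t: "emeasure \<mu> T = ennreal t" "0 \<le> t"
      using emeasure_\<mu>_finite[of a b] by (cases "emeasure \<mu> T") (auto simp: top_unique)
    have "real N * t \<le> 2 * K * V"
      using Ainf_mass_tail[OF K(1) less_imp_le[OF K(2)] ab m, of N] t V K ab
      by (simp add: ennreal_mult[symmetric] m_def T_def)
    moreover have "8 * K * t \<le> real N * t"
      using N t by (intro mult_right_mono)
    ultimately have "K * (8 * t) \<le> K * (2 * V)"
      by (simp add: mult_ac)
    then have "t \<le> V / 4"
      using K(2) by simp
    have "emeasure \<mu> (A - T) = (\<integral>\<^sup>+x\<in>A - T. ennreal (v x) \<partial>lebesgue)"
      by (rule emeasure_\<mu>) simp
    also have "\<dots> \<le> (\<integral>\<^sup>+x\<in>A - T. ennreal (2 ^ N * m) \<partial>lebesgue)"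
      using A by (intro nn_integral_mono) (auto simp: T_def split: split_indicator intro!: ennreal_leI)
    also have "\<dots> = ennreal (2 ^ N * m) * emeasure lebesgue (A - T)"
      by (simp add: nn_integral_cmult_indicator)
    also have "\<dots> \<le> ennreal (2 ^ N * m) * emeasure lebesgue A"
      by (intro mult_left_mono emeasure_mono) auto
    also have "\<dots> \<le> ennreal (2 ^ N * m) * ennreal ((1 / 2) ^ N / 4 * (b - a))"
      by (intro mult_left_mono small) auto
    also have "\<dots> = ennreal (V / 4)"
      using m ab by (simp add: ennreal_mult[symmetric] m_def field_simps)
    finally have "emeasure \<mu> (A - T) \<le> ennreal (V / 4)" .
    moreover have "emeasure \<mu> A \<le> emeasure \<mu> (A - T) + emeasure \<mu> T"
      by (rule order.trans[OF emeasure_mono emeasure_subadditive]) auto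
    ultimately have "emeasure \<mu> A \<le> ennreal (V / 4) + ennreal t"
      using t by (metis add_right_mono order.trans)
    also have "\<dots> \<le> ennreal (V / 2)"
      using \<open>t \<le> V / 4\<close> t V by (simp add: ennreal_plus[symmetric] ennreal_leI del: ennreal_plus)
    finally show ?thesis
      using V by (simp add: divide_ennreal[symmetric])
  qed
qed

end

section \<open>Exponential decay of sublevel sets\<close>

context line_weight
begin

text \<open>
  The halving property for the complement of \<open>A\<close>.
\<close>

lemma dense_subset_mass:
  assumes small: "halving \<alpha>"
    and \<alpha>: "0 \<le> \<alpha>" "\<alpha> \<le> 1"
    and ab: "a < b" and A: "A \<in> sets lebesgue" "A \<subseteq> {a..b}"
    and dense: "ennreal ((1 - \<alpha>) * (b - a)) \<le> emeasure lebesgue A"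
  shows "emeasure \<mu> {a..b} \<le> 2 * emeasure \<mu> A"
proof -
  obtain r where r: "emeasure lebesgue A = ennreal r" "0 \<le> r"
    using emeasure_mono[of A "{a..b}" lebesgue] A ab
    by (cases "emeasure lebesgue A") (auto simp: top_unique)
  have "emeasure lebesgue ({a..b} - A) = emeasure lebesgue {a..b} - emeasure lebesgue A"
    using A r by (intro emeasure_Diff) auto
  also have "\<dots> = ennreal (b - a - r)"
    using ab r by (simp add: ennreal_minus)
  also have "\<dots> \<le> ennreal (\<alpha> * (b - a))"
    using dense r \<alpha> ab by (intro ennreal_leI) (auto simp: algebra_simps)
  finally have half: "emeasure \<mu> ({a..b} - A) \<le> emeasure \<mu> {a..b} / 2"
    using A ab by (intro halvingD[OF small]) auto
  obtain V where V: "emeasure \<mu> {a..b} = ennreal V" "0 \<le> V"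
    using emeasure_\<mu>_finite[of a b] by (cases "emeasure \<mu> {a..b}") auto
  obtain t where t: "emeasure \<mu> A = ennreal t" "0 \<le> t"
    using emeasure_mono[of A "{a..b}" \<mu>] A V
    by (cases "emeasure \<mu> A") (auto simp: top_unique)
  have "emeasure \<mu> {a..b} = emeasure \<mu> A + emeasure \<mu> ({a..b} - A)"
    using A by (subst plus_emeasure) (auto intro!: arg_cong[where f="emeasure \<mu>"])
  also have "\<dots> \<le> ennreal t + ennreal (V / 2)"
    using half V t by (auto intro!: add_mono simp: divide_ennreal[symmetric])
  finally have "V \<le> t + V / 2"
    using V t by (simp add: ennreal_plus[symmetric] del: ennreal_plus)
  then have "V \<le> 2 * t" by simp
  then show ?thesis
    using V t by (simp add: ennreal_mult[symmetric] ennreal_numeral[symmetric] ennreal_leI del: ennreal_numeral)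
qed

text \<open>
  In the induction step a set \<open>A\<close> of density below \<open>1 - \<alpha>\<close> is replaced by the union \<open>U\<close> of the
  intervals in which its density is \<open>1 - \<alpha>\<close>. This contains almost all of \<open>A\<close> since \<open>1 - \<alpha> < 1\<close>. Its
  measure is \<open>|A| / (1 - \<alpha>)\<close>, which lowers the exponent by one, and its mass is at most \<open>2 \<mu>(A)\<close>, as
  \<open>A\<close> is dense in each of the intervals.
\<close>

lemma power_dense_subset_mass:
  assumes small: "halving \<alpha>"
    and \<alpha>: "0 < \<alpha>" "\<alpha> < 1" and ab: "a < b"
  shows "A \<in> sets lebesgue \<Longrightarrow> A \<subseteq> {a..b} \<Longrightarrow>
    ennreal ((1 - \<alpha>) ^ n * (b - a)) \<le> emeasure lebesgue A \<Longrightarrow>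
    emeasure \<mu> {a..b} \<le> 2 ^ n * emeasure \<mu> A"
proof (induction n arbitrary: A)
  case 0
  have "emeasure lebesgue A = ennreal (b - a)"
    using 0 ab emeasure_mono[of A "{a..b}" lebesgue] by (auto intro: antisym)
  moreover from this have "emeasure lebesgue ({a..b} - A) = emeasure lebesgue {a..b} - emeasure lebesgue A"
    using 0 by (intro emeasure_Diff) auto
  ultimately have "emeasure lebesgue ({a..b} - A) = 0"
    using ab by simp
  then have "AE x in lebesgue. x \<in> {a..b} \<longrightarrow> x \<in> A"
    using 0 by (intro AE_I[where N="{a..b} - A"]) auto
  then show ?case
    using 0 by (auto intro!: emeasure_mono_AE AE_\<mu>)
next
  case (Suc n)
  note [measurable] = Suc.prems(1)
  have half: "emeasure \<mu> {c..d} \<le> 2 * emeasure \<mu> B"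
    if "c < d" "B \<in> sets lebesgue" "B \<subseteq> {c..d}" "ennreal ((1 - \<alpha>) * (d - c)) \<le> emeasure lebesgue B" for c d B
    using that \<alpha> by (intro dense_subset_mass[OF small]) auto
  show ?case
  proof (cases "ennreal ((1 - \<alpha>) * (b - a)) \<le> emeasure lebesgue A")
    case True
    have "emeasure \<mu> {a..b} \<le> 2 * emeasure \<mu> A"
      using True ab Suc.prems by (intro half) auto
    also have "\<dots> \<le> 2 ^ Suc n * emeasure \<mu> A"
    proof (rule mult_right_mono)
      have "(2::ennreal) ^ 1 \<le> 2 ^ Suc n"
        by (intro power_increasing) auto
      then show "(2::ennreal) \<le> 2 ^ Suc n" by simp
    qed simp
    finally show ?thesis .
  next
    case False
    have "(\<integral>\<^sup>+x\<in>{a..b}. ennreal (indicator A x) \<partial>lebesgue) = emeasure lebesgue A"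
    proof -
      have "(\<integral>\<^sup>+x\<in>{a..b}. ennreal (indicator A x) \<partial>lebesgue) = (\<integral>\<^sup>+x. indicator A x \<partial>lebesgue)"
        using Suc.prems by (intro nn_integral_cong) (auto split: split_indicator)
      then show ?thesis by simp
    qed
    also have "\<dots> \<le> ennreal (1 - \<alpha>) * emeasure lebesgue {a..b}"
      using False \<alpha> ab by (simp add: ennreal_mult)
    finally have avg: "(\<integral>\<^sup>+x\<in>{a..b}. ennreal (indicator A x) \<partial>lebesgue) \<le> ennreal (1 - \<alpha>) * emeasure lebesgue {a..b}" .
    obtain D where D: "countable D" "disjoint D"
      and int: "\<And>J. J \<in> D \<Longrightarrow> \<exists>c d. c < d \<and> a \<le> c \<and> d \<le> b \<and> J = {c<..<d}"
      and eq: "\<And>J. J \<in> D \<Longrightarrow> (\<integral>\<^sup>+x\<in>J. ennreal (indicator A x) \<partial>lebesgue) = ennreal (1 - \<alpha>) * emeasure lebesgue J"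
      and off: "AE x in lebesgue. x \<in> {a..b} - \<Union>D \<longrightarrow> indicator A x \<le> 1 - \<alpha>"
      using \<alpha> by (rule_tac calderon_zygmund[OF _ _ ab _ avg]) auto
    have D_sets: "J \<in> sets lebesgue" if "J \<in> D" for J
      using int[OF that] by (auto simp: borel_open)
    have AJ: "emeasure lebesgue (A \<inter> J) = ennreal (1 - \<alpha>) * emeasure lebesgue J" if J: "J \<in> D" for J
    proof -
      have "(\<integral>\<^sup>+x\<in>J. ennreal (indicator A x) \<partial>lebesgue) = (\<integral>\<^sup>+x. indicator (A \<inter> J) x \<partial>lebesgue)"
        by (intro nn_integral_cong) (auto split: split_indicator)
      also have "\<dots> = emeasure lebesgue (A \<inter> J)"
        using D_sets[OF J] by (intro nn_integral_indicator) auto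
      finally show ?thesis using eq[OF J] by simp
    qed
    define U where "U = \<Union>D"
    have "J \<subseteq> {a..b}" if "J \<in> D" for J
      using int[OF that] by auto
    moreover have "\<Union>D \<in> sets lebesgue"
      using D_sets by (intro sets.countable_Union D) auto
    ultimately have U: "U \<in> sets lebesgue" "U \<subseteq> {a..b}"
      unfolding U_def by blast+
    have "ennreal ((1 - \<alpha>) * ((1 - \<alpha>) ^ n * (b - a))) \<le> emeasure lebesgue A"
      using Suc.prems by (simp add: mult.assoc)
    also have "\<dots> \<le> emeasure lebesgue (A \<inter> U)"
    proof (rule emeasure_mono_AE)
      show "AE x in lebesgue. x \<in> A \<longrightarrow> x \<in> A \<inter> U"
        using off by eventually_elim (use Suc.prems \<alpha> in \<open>auto simp: U_def\<close>)
    qed (use U Suc.prems in auto)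
    also have "\<dots> \<le> ennreal (1 - \<alpha>) * emeasure lebesgue (UNIV \<inter> U)"
      unfolding U_def by (rule emeasure_Union_le[OF D]) (use D_sets AJ in auto)
    finally have "ennreal (1 - \<alpha>) * ennreal ((1 - \<alpha>) ^ n * (b - a)) \<le> ennreal (1 - \<alpha>) * emeasure lebesgue U"
      using \<alpha> ab by (simp add: ennreal_mult)
    then have "ennreal ((1 - \<alpha>) ^ n * (b - a)) \<le> emeasure lebesgue U"
      using \<alpha> by (subst (asm) ennreal_mult_le_mult_iff) auto
    then have le_U: "emeasure \<mu> {a..b} \<le> 2 ^ n * emeasure \<mu> U"
      by (rule Suc.IH[OF U])
    have "emeasure \<mu> (UNIV \<inter> U) \<le> 2 * emeasure \<mu> (A \<inter> U)"
      unfolding U_def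
    proof (rule emeasure_Union_le[OF D])
      fix J assume J: "J \<in> D"
      then obtain c d where cd: "c < d" "a \<le> c" "d \<le> b" "J = {c<..<d}"
        using int by blast
      have "emeasure \<mu> J \<le> emeasure \<mu> {c..d}"
        using cd by (intro emeasure_mono) auto
      also have "\<dots> \<le> 2 * emeasure \<mu> (A \<inter> J)"
        using cd \<alpha> AJ[OF J] D_sets[OF J] Suc.prems by (intro half) (auto simp: ennreal_mult)
      finally show "emeasure \<mu> (UNIV \<inter> J) \<le> 2 * emeasure \<mu> (A \<inter> J)" by simp
    qed (use D_sets Suc.prems in auto)
    also have "2 * emeasure \<mu> (A \<inter> U) \<le> 2 * emeasure \<mu> A"
      using Suc.prems by (intro mult_left_mono emeasure_mono) auto
    finally have "2 ^ n * emeasure \<mu> U \<le> 2 ^ n * (2 * emeasure \<mu> A)"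
      by (intro mult_left_mono) auto
    with le_U show ?thesis
      by (simp add: mult_ac)
  qed
qed

text \<open>
  If the sublevel set \<open>E\<close> were larger, then \<open>\<mu>(I) \<le> 2\<^sup>n \<mu>(E) \<le> 2\<^sup>n 4\<^sup>-\<^sup>n m |I| < \<mu>(I)\<close>.
\<close>

lemma sublevel_measure:
  assumes small: "halving \<alpha>"
    and \<alpha>: "0 < \<alpha>" "\<alpha> < 1" and ab: "a < b"
    and m: "emeasure \<mu> {a..b} = ennreal (m * (b - a))" "0 < m"
  shows "emeasure lebesgue {x \<in> {a..b}. v x < (1 / 4) ^ n * m} \<le> ennreal ((1 - \<alpha>) ^ n * (b - a))"
proof (cases "n = 0")
  case True
  have "emeasure lebesgue {x \<in> {a..b}. v x < (1 / 4) ^ n * m} \<le> emeasure lebesgue {a..b}"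
    by (rule emeasure_mono) auto
  then show ?thesis using True ab by simp
next
  case False
  define E where "E = {x \<in> {a..b}. v x < (1 / 4) ^ n * m}"
  have [measurable]: "E \<in> sets lebesgue"
    unfolding E_def by measurable
  have E: "E \<subseteq> {a..b}"
    unfolding E_def by auto
  show ?thesis
  proof (rule ccontr)
    assume "\<not> ?thesis"
    then have "ennreal ((1 - \<alpha>) ^ n * (b - a)) \<le> emeasure lebesgue E"
      by (simp add: E_def)
    then have "emeasure \<mu> {a..b} \<le> 2 ^ n * emeasure \<mu> E"
      using E by (intro power_dense_subset_mass[OF small \<alpha> ab]) auto
    also have "emeasure \<mu> E = (\<integral>\<^sup>+x\<in>E. ennreal (v x) \<partial>lebesgue)"
      by (simp add: emeasure_\<mu>)
    also have "\<dots> \<le> (\<integral>\<^sup>+x\<in>E. ennreal ((1 / 4) ^ n * m) \<partial>lebesgue)"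
      by (intro nn_integral_mono) (auto simp: E_def split: split_indicator intro!: ennreal_leI)
    also have "\<dots> = ennreal ((1 / 4) ^ n * m) * emeasure lebesgue E"
      by (simp add: nn_integral_cmult_indicator)
    also have "\<dots> \<le> ennreal ((1 / 4) ^ n * m) * emeasure lebesgue {a..b}"
      using E by (intro mult_left_mono emeasure_mono) auto
    also have "2 ^ n * \<dots> = ennreal (2 ^ n * ((1 / 4) ^ n * m * (b - a)))"
      using ab m by (simp add: ennreal_mult ennreal_power[symmetric])
    finally have "m * (b - a) \<le> 2 ^ n * ((1 / 4) ^ n * m * (b - a))"
      using m ab by (auto simp: mult_left_mono)
    also have "\<dots> = (2 * (1 / 4)) ^ n * (m * (b - a))"
      by (simp only: power_mult_distrib mult.assoc)
    finally have "1 \<le> (1 / 2 :: real) ^ n"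
      using m ab by simp
    moreover have "(1 / 2 :: real) ^ n < 1"
      using False by (simp add: power_less_one_iff)
    ultimately show False by simp
  qed
qed

end

section \<open>Integrability of negative powers\<close>

text \<open>
  The suprema defining the constants range over intervals of every kind. This and the next lemmas
  allow to replace any of them by a closed interval, as endpoints do not contribute to integrals.
\<close>

lemma bdd_interval_Icc:
  assumes "I \<in> bdd_intervals"
  obtains a b where "a < b" "I \<subseteq> {a..b}" "{a<..<b} \<subseteq> I"
proof -
  have I: "connected I" "bounded I" "0 < emeasure lebesgue I"
    using assms by (auto simp: bdd_intervals_def is_interval_connected)
  have "I \<noteq> {}"
    using I(3) by auto
  have bb: "bdd_below I" "bdd_above I"
    using I(2) by (auto intro: bounded_imp_bdd_below bounded_imp_bdd_above)
  have sub: "I \<subseteq> {Inf I..Sup I}"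
    using bb by (auto intro: cInf_lower cSup_upper)
  moreover have "{Inf I<..<Sup I} \<subseteq> I"
  proof
    fix x assume x: "x \<in> {Inf I<..<Sup I}"
    obtain y where "y \<in> I" "y < x"
      using x cInf_less_iff[OF \<open>I \<noteq> {}\<close> bb(1)] by auto
    moreover obtain z where "z \<in> I" "x < z"
      using x less_cSup_iff[OF \<open>I \<noteq> {}\<close> bb(2)] by auto
    ultimately show "x \<in> I"
      using connectedD_interval[OF I(1), of y z x] by simp
  qed
  moreover have "Inf I < Sup I"
  proof (rule ccontr)
    assume "\<not> Inf I < Sup I"
    then have "I \<subseteq> {Inf I}"
      using sub by auto
    then have "emeasure lebesgue I \<le> emeasure lebesgue {Inf I}"
      by (intro emeasure_mono) auto
    then show False using I(3) by simp
  qed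
  ultimately show thesis using that by blast
qed

lemma AE_interval_endpoints:
  assumes "I \<subseteq> {a..b}" "{a<..<b} \<subseteq> (I :: real set)"
  shows "AE x in lebesgue. x \<in> I \<longleftrightarrow> x \<in> {a..b}"
proof (rule AE_I')
  show "{a, b} \<in> null_sets lebesgue"
    by (simp add: negligible_iff_null_sets[symmetric])
  show "{x \<in> space lebesgue. \<not> (x \<in> I \<longleftrightarrow> x \<in> {a..b})} \<subseteq> {a, b}"
    using assms by force
qed

lemma set_nn_integral_interval_endpoints:
  assumes "I \<subseteq> {a..b}" "{a<..<b} \<subseteq> (I :: real set)"
  shows "(\<integral>\<^sup>+x\<in>I. f x \<partial>lebesgue) = (\<integral>\<^sup>+x\<in>{a..b}. f x \<partial>lebesgue)"
  using AE_interval_endpoints[OF assms]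
  by (intro nn_integral_cong_AE, eventually_elim) (auto split: split_indicator)

lemma emeasure_interval_endpoints:
  assumes "I \<subseteq> {a..b}" "{a<..<b} \<subseteq> (I :: real set)" "a < b"
  shows "emeasure lebesgue I = ennreal (b - a)"
proof -
  have "I \<in> sets lebesgue"
  proof -
    have "I = {a<..<b} \<union> (I \<inter> {a, b})"
      using assms by force
    moreover have "I \<inter> {a, b} \<in> sets lebesgue"
      by (intro sets_completionI_sets) (auto intro!: borel_closed finite_imp_closed)
    ultimately show ?thesis
      by (metis sets.Un sets_completionI_sets greaterThanLessThan_borel sets_lborel)
  qed
  then have "emeasure lebesgue I = (\<integral>\<^sup>+x\<in>I. 1 \<partial>lebesgue)"
    by simp
  also have "\<dots> = (\<integral>\<^sup>+x\<in>{a..b}. 1 \<partial>lebesgue)"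
    by (rule set_nn_integral_interval_endpoints[OF assms(1,2)])
  also have "\<dots> = ennreal (b - a)"
    using assms by simp
  finally show ?thesis .
qed

lemma epowr_ennreal: "0 < x \<Longrightarrow> epowr (ennreal x) a = ennreal (x powr a)"
  by (auto simp: epowr_def powr_zero_eq_one)

lemma epowr_mono:
  assumes "0 \<le> a" "x \<le> y"
  shows "epowr x a \<le> epowr y a"
proof (cases "y = \<infinity> \<or> x = 0 \<or> a = 0")
  case True
  then show ?thesis using assms by (auto simp: epowr_def)
next
  case False
  then have "0 < x" "y < \<infinity>" "x < \<infinity>"
    using assms(2) by (auto simp: less_top zero_less_iff_neq_zero top_unique)
  then have "enn2real x \<le> enn2real y" "y \<noteq> 0" "y \<noteq> \<infinity>" "x \<noteq> \<infinity>"
    using assms(2) by (auto simp: enn2real_mono)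
  then show ?thesis
    using False assms(1) by (auto simp: epowr_def intro!: ennreal_leI powr_mono2)
qed

context line_weight
begin

text \<open>
  If \<open>4\<^sup>-\<^sup>n\<^sup>-\<^sup>1 m \<le> v x < 4\<^sup>-\<^sup>n m\<close>, then the summand with index \<open>n\<close> alone dominates the left-hand side;
  the \<open>1\<close> takes care of \<open>v x \<ge> m\<close>.
\<close>

lemma epowr_layer_cake:
  assumes "0 < s" "0 < m" "0 < v x"
  shows "epowr (ennreal (v x)) (- s) \<le> ennreal (m powr (- s)) *
    (1 + (\<Sum>n. ennreal (4 powr (s * real (Suc n))) * indicator {x. v x < (1 / 4) ^ n * m} x))"
    (is "_ \<le> _ * (1 + (\<Sum>n. ?g n))")
proof (cases "m \<le> v x")
  case True
  have "v x powr (- s) \<le> m powr (- s)"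
    using True assms by (intro powr_mono2') auto
  then have "ennreal (v x powr (- s)) \<le> ennreal (m powr (- s)) * 1"
    by (auto intro: ennreal_leI)
  also have "\<dots> \<le> ennreal (m powr (- s)) * (1 + (\<Sum>n. ?g n))"
    by (intro mult_left_mono) auto
  finally show ?thesis
    using assms by (simp add: epowr_ennreal)
next
  case False
  have "\<exists>n. (1 / 4) ^ n * m \<le> v x"
  proof -
    obtain n where "(1 / 4 :: real) ^ n < v x / m"
      using real_arch_pow_inv[of "v x / m" "1 / 4"] assms by auto
    then show ?thesis
      using assms by (auto simp: field_simps intro!: exI[of _ n])
  qed
  then obtain k where k: "(1 / 4) ^ k * m \<le> v x" "\<And>i. i < k \<Longrightarrow> v x < (1 / 4) ^ i * m"
    using exists_least_iff[of "\<lambda>n. (1 / 4) ^ n * m \<le> v x"] by (auto simp: not_le)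
  then obtain n where n: "k = Suc n"
    using False by (cases k) auto
  have "v x powr (- s) \<le> ((1 / 4) ^ k * m) powr (- s)"
    using k assms by (intro powr_mono2') auto
  also have "((1 / 4) ^ k * m) powr (- s) = m powr (- s) * 4 powr (s * real (Suc n))"
  proof -
    have "(1 / 4 :: real) ^ k = 4 powr (- real k)"
      by (simp add: powr_minus powr_realpow power_one_over inverse_eq_divide)
    then show ?thesis
      using assms n by (simp add: powr_mult powr_powr algebra_simps)
  qed
  finally have "ennreal (v x powr (- s)) \<le> ennreal (m powr (- s)) * ennreal (4 powr (s * real (Suc n)))"
    by (simp add: ennreal_mult[symmetric] ennreal_leI)
  also have "ennreal (4 powr (s * real (Suc n))) = (\<Sum>i\<in>{n}. ?g i)"
    using k(2)[of n] n by simp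
  also have "\<dots> \<le> (\<Sum>n. ?g n)"
    by (intro sum_le_suminf) auto
  also have "(\<Sum>n. ?g n) \<le> 1 + (\<Sum>n. ?g n)"
    by simp
  finally show ?thesis
    using assms by (simp add: epowr_ennreal mult_left_mono)
qed

text \<open>
  By the decay of the sublevel sets the layer cake sum is a geometric series with ratio
  \<open>q = 4\<^sup>s (1 - \<alpha>)\<close>. The condition on \<open>s\<close> makes \<open>4\<^sup>s\<close> at most \<open>e\<^bsup>\<alpha>/2\<^esup>\<close>, so that \<open>q \<le> 1 - \<alpha> / 2\<close> and the
  sum is of the order \<open>1 / \<alpha>\<close>.
\<close>

lemma negative_power_integral:
  assumes small: "halving \<alpha>"
    and \<alpha>: "0 < \<alpha>" "\<alpha> < 1" and ab: "a < b"
    and m: "emeasure \<mu> {a..b} = ennreal (m * (b - a))" "0 < m"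
    and s: "0 < s" "s \<le> \<alpha> / 4"
  shows "(\<integral>\<^sup>+x\<in>{a..b}. epowr (ennreal (v x)) (- s) \<partial>lebesgue) \<le> ennreal (m powr (- s) * (5 / \<alpha>) * (b - a))"
proof -
  define E where "E n = {x. v x < (1 / 4) ^ n * m}" for n :: nat
  define E' where "E' n = {x \<in> {a..b}. v x < (1 / 4) ^ n * m}" for n :: nat
  have [measurable]: "E' n \<in> sets lebesgue" for n
    unfolding E'_def by measurable
  have E'_eq: "E' n = {a..b} \<inter> E n" for n
    by (auto simp: E_def E'_def)
  have E': "emeasure lebesgue (E' n) \<le> ennreal ((1 - \<alpha>) ^ n * (b - a))" for n
    unfolding E'_def by (rule sublevel_measure[OF small \<alpha> ab m])
  have "AE x in lebesgue. x \<in> {a..b} \<longrightarrow> 0 < v x"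
  proof -
    define Z where "Z = {x \<in> {a..b}. v x \<le> 0}"
    have [measurable]: "Z \<in> sets lebesgue"
      unfolding Z_def by measurable
    have "(\<lambda>n. ennreal ((1 - \<alpha>) ^ n * (b - a))) \<longlonglongrightarrow> ennreal (0 * (b - a))"
      using \<alpha> by (intro tendsto_intros LIMSEQ_power_zero) auto
    moreover have "emeasure lebesgue Z \<le> ennreal ((1 - \<alpha>) ^ n * (b - a))" for n
    proof -
      have "Z \<subseteq> E' n"
        using m by (auto simp: Z_def E'_def intro: le_less_trans)
      then show ?thesis
        using E'[of n] emeasure_mono[of Z "E' n" lebesgue] by auto
    qed
    ultimately have "emeasure lebesgue Z \<le> ennreal (0 * (b - a))"
      by (intro LIMSEQ_le_const) auto
    then show ?thesis
      by (intro AE_I[where N=Z]) (auto, auto simp: Z_def)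
  qed
  then have "(\<integral>\<^sup>+x\<in>{a..b}. epowr (ennreal (v x)) (- s) \<partial>lebesgue)
      \<le> (\<integral>\<^sup>+x. ennreal (m powr (- s)) * (indicator {a..b} x +
          (\<Sum>n. ennreal (4 powr (s * real (Suc n))) * indicator (E' n) x)) \<partial>lebesgue)"
  proof (intro nn_integral_mono_AE, eventually_elim)
    case (elim x)
    show ?case
    proof (cases "x \<in> {a..b}")
      case True
      then have "indicator (E' n) x = (indicator (E n) x :: ennreal)" for n
        by (auto simp: E'_eq split: split_indicator)
      then show ?thesis
        using epowr_layer_cake[OF s(1) m(2), of x] elim True by (simp add: E_def)
    qed simp
  qed
  also have "\<dots> = ennreal (m powr (- s)) * (emeasure lebesgue {a..b} +
      (\<Sum>n. ennreal (4 powr (s * real (Suc n))) * emeasure lebesgue (E' n)))"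
    by (simp add: nn_integral_cmult nn_integral_add nn_integral_suminf nn_integral_cmult_indicator
        del: emeasure_completion)
  also have "\<dots> \<le> ennreal (m powr (- s)) * ennreal (5 / \<alpha> * (b - a))"
  proof (rule mult_left_mono)
    have "4 powr s = exp (s * ln 4)"
      by (simp add: powr_def)
    also have "\<dots> \<le> exp (\<alpha> / 2)"
    proof -
      have "ln (4::real) = 2 * ln 2"
        using ln_realpow[of 2 2] by simp
      then have "ln (4::real) \<le> 2"
        using ln_2_less_1 by simp
      then have "s * ln 4 \<le> \<alpha> / 4 * 2"
        using s \<alpha> by (intro mult_mono) auto
      then show ?thesis by simp
    qed
    also have "\<dots> \<le> 1 + \<alpha> / 2 + (\<alpha> / 2)\<^sup>2"
      using \<alpha> by (intro exp_bound) auto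
    finally have p4: "4 powr s \<le> 1 + \<alpha> / 2 + \<alpha>\<^sup>2 / 4"
      by (simp add: power2_eq_square)
    define q where "q = 4 powr s * (1 - \<alpha>)"
    have "q \<le> (1 + \<alpha> / 2 + \<alpha>\<^sup>2 / 4) * (1 - \<alpha>)"
      unfolding q_def using p4 \<alpha> by (intro mult_right_mono) auto
    also have "\<dots> = 1 - \<alpha> / 2 - \<alpha>\<^sup>2 / 4 - \<alpha> ^ 3 / 4"
      by (simp add: field_simps power2_eq_square power3_eq_cube)
    also have "\<dots> \<le> 1 - \<alpha> / 2"
      using zero_le_power2[of \<alpha>] zero_le_power[of \<alpha> 3] \<alpha> by linarith
    finally have q: "q \<le> 1 - \<alpha> / 2" .
    have q0: "0 \<le> q"
      using \<alpha> by (simp add: q_def)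
    have "\<alpha>\<^sup>2 \<le> 1"
      using \<alpha> by (simp add: power_le_one)
    then have p2: "4 powr s \<le> 2"
      using p4 \<alpha> by simp
    have "(\<Sum>n. ennreal (4 powr (s * real (Suc n))) * emeasure lebesgue (E' n))
        \<le> (\<Sum>n. ennreal (4 powr s * (b - a) * q ^ n))"
    proof (intro suminf_le)
      fix n
      have "ennreal (4 powr (s * real (Suc n))) * emeasure lebesgue (E' n)
          \<le> ennreal (4 powr (s * real (Suc n))) * ennreal ((1 - \<alpha>) ^ n * (b - a))"
        by (intro mult_left_mono E') auto
      also have "\<dots> = ennreal (4 powr (s * real (Suc n)) * ((1 - \<alpha>) ^ n * (b - a)))"
        using \<alpha> ab by (intro ennreal_mult[symmetric]) auto
      also have "4 powr (s * real (Suc n)) * ((1 - \<alpha>) ^ n * (b - a)) = 4 powr s * (b - a) * q ^ n"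
      proof -
        have "4 powr (s * real (Suc n)) = 4 powr s * (4 powr s) ^ n"
          by (simp add: algebra_simps powr_add powr_realpow[symmetric] powr_powr)
        then show ?thesis
          by (simp add: q_def power_mult_distrib)
      qed
      finally show "ennreal (4 powr (s * real (Suc n))) * emeasure lebesgue (E' n)
          \<le> ennreal (4 powr s * (b - a) * q ^ n)" .
    qed auto
    also have "\<dots> = ennreal (\<Sum>n. 4 powr s * (b - a) * q ^ n)"
      using q q0 \<alpha> ab by (intro suminf_ennreal2 summable_mult summable_geometric) auto
    also have "(\<Sum>n. 4 powr s * (b - a) * q ^ n) = 4 powr s * (b - a) * (1 / (1 - q))"
      using q q0 \<alpha> by (subst suminf_mult) (auto intro!: summable_geometric simp: suminf_geometric)
    also have "\<dots> \<le> 2 * (b - a) * (1 / (\<alpha> / 2))"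
      using q q0 \<alpha> ab p2 by (intro mult_mono divide_left_mono) auto
    finally have "emeasure lebesgue {a..b} + (\<Sum>n. ennreal (4 powr (s * real (Suc n))) * emeasure lebesgue (E' n))
        \<le> ennreal (b - a) + ennreal (2 * (b - a) * (1 / (\<alpha> / 2)))"
      using ab by (intro add_mono) (auto simp: ennreal_leI)
    also have "\<dots> = ennreal ((b - a) + 2 * (b - a) * (1 / (\<alpha> / 2)))"
      using ab \<alpha> by (intro ennreal_plus[symmetric]) auto
    also have "\<dots> \<le> ennreal (5 / \<alpha> * (b - a))"
    proof (rule ennreal_leI)
      define r where "r = 1 / \<alpha> * (b - a)"
      have "1 * (b - a) \<le> r"
        unfolding r_def using \<alpha> ab by (intro mult_right_mono) auto
      then have "(b - a) + 4 * r \<le> 5 * r"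
        by simp
      then show "(b - a) + 2 * (b - a) * (1 / (\<alpha> / 2)) \<le> 5 / \<alpha> * (b - a)"
        by (simp add: r_def)
    qed
    finally show "emeasure lebesgue {a..b} + (\<Sum>n. ennreal (4 powr (s * real (Suc n))) * emeasure lebesgue (E' n))
        \<le> ennreal (5 / \<alpha> * (b - a))" .
  qed simp
  finally show ?thesis
    using \<alpha> ab by (simp add: ennreal_mult[symmetric] mult.assoc)
qed

end

section \<open>The one-dimensional theorem\<close>

lemma average_interval_endpoints:
  assumes "I \<subseteq> {a..b}" "{a<..<b} \<subseteq> (I :: real set)" "a < b"
  shows "average f I = (\<integral>\<^sup>+x\<in>{a..b}. f x \<partial>lebesgue) / ennreal (b - a)"
  unfolding average_def
  using assms by (simp add: set_nn_integral_interval_endpoints[OF assms(1,2)]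
      emeasure_interval_endpoints[OF assms] del: emeasure_completion)

context line_weight
begin

text \<open>
  On \<open>I\<close> the maximal function is at least the average over \<open>I\<close> itself. Therefore a constant below \<open>1\<close>
  is only possible for the zero weight.
\<close>

lemma one_le_Ainf_const:
  assumes ab: "a < b" and pos: "0 < emeasure \<mu> {a..b}"
  shows "1 \<le> Ainf_const v"
proof -
  let ?I = "{a..b}" and ?M = "maximal (\<lambda>y. v y * indicator {a..b} y)"
  have I: "?I \<in> bdd_intervals"
    using ab by (auto simp: bdd_intervals_def is_interval_cc)
  obtain V where V: "emeasure \<mu> ?I = ennreal V" "0 < V"
    using emeasure_\<mu>_finite[of a b] pos by (cases "emeasure \<mu> ?I") auto
  have "ennreal (V / (b - a)) \<le> ?M x" if x: "x \<in> ?I" for x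
  proof -
    have "average (\<lambda>y. ennreal \<bar>v y * indicator ?I y\<bar>) ?I = (\<integral>\<^sup>+x\<in>?I. ennreal (v x) \<partial>lebesgue) / emeasure lebesgue ?I"
      unfolding average_def using nonneg
      by (intro arg_cong2[where f="(/)"] nn_integral_cong) (auto split: split_indicator)
    also have "\<dots> = ennreal (V / (b - a))"
      using V ab by (simp add: emeasure_\<mu>[symmetric] divide_ennreal)
    finally have "ennreal (V / (b - a)) = average (\<lambda>y. ennreal \<bar>v y * indicator ?I y\<bar>) ?I" ..
    then show ?thesis
      unfolding maximal_def using I x by (auto intro!: SUP_upper)
  qed
  then have "(\<integral>\<^sup>+x\<in>?I. ennreal (V / (b - a)) \<partial>lebesgue) \<le> (\<integral>\<^sup>+x\<in>?I. ?M x \<partial>lebesgue)"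
    by (intro nn_integral_mono) (auto split: split_indicator)
  moreover have "(\<integral>\<^sup>+x\<in>?I. ennreal (V / (b - a)) \<partial>lebesgue) = ennreal V"
    using ab V by (simp add: nn_integral_cmult_indicator ennreal_mult[symmetric])
  ultimately have "ennreal V / ennreal V \<le> (\<integral>\<^sup>+x\<in>?I. ?M x \<partial>lebesgue) / ennreal V"
    by (intro divide_right_mono_ennreal) simp
  moreover have "ennreal V / ennreal V = 1"
    using V(2) by (simp add: divide_ennreal)
  moreover have "(\<integral>\<^sup>+x\<in>?I. ennreal (v x) \<partial>lebesgue) = ennreal V"
    using V(1) by (simp add: emeasure_\<mu>)
  ultimately have "1 \<le> (\<integral>\<^sup>+x\<in>?I. ?M x \<partial>lebesgue) / (\<integral>\<^sup>+x\<in>?I. ennreal (v x) \<partial>lebesgue)"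
    by (simp only:)
  also have "\<dots> \<le> Ainf_const v"
    unfolding Ainf_const_def by (rule SUP_upper[OF I])
  finally show ?thesis .
qed

text \<open>
  With \<open>s = 1 / (p - 1)\<close> the factor \<open>m\<^sup>-\<^sup>s\<close> of the bound for the average of \<open>v\<^sup>-\<^sup>s\<close> becomes \<open>1 / m\<close> in
  the power \<open>p - 1\<close>, and cancels the average \<open>m\<close> of \<open>v\<close>.
\<close>

lemma Ap_const_le_of_small:
  assumes small: "halving \<alpha>"
    and \<alpha>: "0 < \<alpha>" "\<alpha> < 1" and p: "4 / \<alpha> \<le> p - 1"
  shows "Ap_const p v \<le> ennreal ((5 / \<alpha>) powr (p - 1))"
  unfolding Ap_const_def
proof (rule SUP_least)
  fix I assume "I \<in> bdd_intervals"
  then obtain a b where ab: "a < b" and I: "I \<subseteq> {a..b}" "{a<..<b} \<subseteq> I"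
    by (rule bdd_interval_Icc)
  have p1: "0 < p - 1"
    using \<alpha> p by (smt (verit) divide_pos_pos)
  define s where "s = 1 / (p - 1)"
  have s: "0 < s" "s \<le> \<alpha> / 4"
    using p p1 \<alpha> by (auto simp: s_def field_simps)
  have avg_v: "average (\<lambda>x. ennreal (v x)) I = emeasure \<mu> {a..b} / ennreal (b - a)"
    by (simp add: average_interval_endpoints[OF I ab] emeasure_\<mu>)
  show "average (\<lambda>x. ennreal (v x)) I * epowr (average (\<lambda>x. epowr (ennreal (v x)) (- 1 / (p - 1))) I) (p - 1)
      \<le> ennreal ((5 / \<alpha>) powr (p - 1))"
  proof (cases "emeasure \<mu> {a..b} = 0")
    case True
    then show ?thesis by (simp add: avg_v)
  next
    case False
    then obtain V where V: "emeasure \<mu> {a..b} = ennreal V" "0 < V"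
      using emeasure_\<mu>_finite[of a b] by (cases "emeasure \<mu> {a..b}") (auto simp: less_le)
    define m where "m = V / (b - a)"
    have m: "emeasure \<mu> {a..b} = ennreal (m * (b - a))" "0 < m"
      using V ab by (auto simp: m_def)
    have "average (\<lambda>x. epowr (ennreal (v x)) (- s)) I
        \<le> ennreal (m powr (- s) * (5 / \<alpha>) * (b - a)) / ennreal (b - a)"
      unfolding average_interval_endpoints[OF I ab]
      by (intro divide_right_mono_ennreal negative_power_integral[OF small \<alpha> ab m s])
    also have "\<dots> = ennreal (m powr (- s) * (5 / \<alpha>))"
      using ab \<alpha> by (subst divide_ennreal) auto
    finally have "epowr (average (\<lambda>x. epowr (ennreal (v x)) (- s)) I) (p - 1)
        \<le> epowr (ennreal (m powr (- s) * (5 / \<alpha>))) (p - 1)"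
      using p1 by (intro epowr_mono) auto
    also have "\<dots> = ennreal ((m powr (- s) * (5 / \<alpha>)) powr (p - 1))"
      using m \<alpha> by (intro epowr_ennreal) simp
    also have "(m powr (- s) * (5 / \<alpha>)) powr (p - 1) = 1 / m * (5 / \<alpha>) powr (p - 1)"
    proof -
      have "- s * (p - 1) = - 1"
        using p1 by (simp add: s_def)
      then have "(m powr (- s)) powr (p - 1) = 1 / m"
        using m by (simp only: powr_powr) (simp add: powr_minus_divide)
      then show ?thesis
        using m \<alpha> by (subst powr_mult) auto
    qed
    finally have "average (\<lambda>x. ennreal (v x)) I * epowr (average (\<lambda>x. epowr (ennreal (v x)) (- s)) I) (p - 1)
        \<le> ennreal m * ennreal (1 / m * (5 / \<alpha>) powr (p - 1))"
      using m ab by (intro mult_mono) (auto simp: avg_v divide_ennreal)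
    also have "\<dots> = ennreal ((5 / \<alpha>) powr (p - 1))"
      using m by (simp add: ennreal_mult[symmetric])
    finally show ?thesis by (simp add: s_def)
  qed
qed

text \<open>
  With \<open>N\<close> the least integer with \<open>N \<ge> 8 K\<close> and \<open>\<alpha> = 2\<^sup>-\<^sup>N / 4\<close>, both \<open>1 + 4 / \<alpha>\<close> and \<open>5 / \<alpha>\<close> are at most
  \<open>32 \<cdot> 2\<^sup>N\<close>. Here \<open>2\<^sup>N \<le> e\<^sup>9\<^sup>K\<close> and \<open>32 \<le> e\<^sup>5\<^sup>K\<close>, as \<open>K \<ge> 1\<close>; the constant \<open>16\<close> leaves some room.
\<close>

lemma Ap_const_le:
  assumes K: "Ainf_const v \<le> ennreal K" "1 \<le> K" and p: "exp (16 * K) \<le> p"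
  shows "Ap_const p v \<le> ennreal (exp (exp (16 * p * K)))"
proof -
  define N where "N = nat \<lceil>8 * K\<rceil>"
  have N: "8 * K \<le> real N" "real N \<le> 9 * K"
    using K(2) by (auto simp: N_def) linarith
  define \<alpha> where "\<alpha> = (1 / 2 :: real) ^ N / 4"
  have \<alpha>: "0 < \<alpha>" "\<alpha> < 1"
    using power_le_one[of "1 / 2 :: real" N] by (auto simp: \<alpha>_def)
  have inv_\<alpha>: "1 / \<alpha> = 4 * 2 ^ N"
    by (simp add: \<alpha>_def field_simps power_one_over)
  have e1: "(2::real) \<le> exp 1"
    using exp_ge_add_one_self[of 1] by simp
  have "(2::real) ^ N \<le> exp 1 ^ N"
    using e1 by (intro power_mono) auto
  also have "\<dots> = exp (real N)"
    by (simp add: exp_of_nat_mult[symmetric])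
  also have "\<dots> \<le> exp (9 * K)"
    using N by simp
  finally have 2: "(2::real) ^ N \<le> exp (9 * K)" .
  have "(2::real) ^ 5 \<le> exp 1 ^ 5"
    using e1 by (intro power_mono) auto
  also have "\<dots> = exp 5"
    by (simp add: exp_of_nat_mult[symmetric])
  also have "\<dots> \<le> exp (5 * K)"
    using K by simp
  finally have "32 * 2 ^ N \<le> exp (5 * K) * exp (9 * K)"
    using 2 by (intro mult_mono) auto
  then have 32: "32 * 2 ^ N \<le> exp (14 * K)"
    by (simp add: exp_add[symmetric])
  have p1: "1 \<le> p"
    using p K(2) one_le_exp_iff[of "16 * K"] by linarith
  have one_le: "(1::real) \<le> 2 ^ N"
    by simp
  have "4 / \<alpha> = 16 * 2 ^ N" "5 / \<alpha> = 20 * 2 ^ N"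
    using inv_\<alpha> by (simp_all add: field_simps)
  moreover have "exp (14 * K) \<le> exp (16 * K)"
    using K by simp
  ultimately have "4 / \<alpha> \<le> p - 1" and 5: "5 / \<alpha> \<le> exp (14 * K)"
    using 32 p one_le by linarith+
  then have "Ap_const p v \<le> ennreal ((5 / \<alpha>) powr (p - 1))"
    using Ainf_imp_halving[OF K(1) _ N(1)] K(2) \<alpha> by (intro Ap_const_le_of_small) (auto simp: \<alpha>_def)
  also have "(5 / \<alpha>) powr (p - 1) \<le> exp (exp (16 * p * K))"
  proof -
    have "(5 / \<alpha>) powr (p - 1) \<le> exp (14 * K) powr (p - 1)"
      using 5 \<alpha> p1 by (intro powr_mono2) auto
    also have "\<dots> = exp (14 * K * (p - 1))"
      by (simp add: powr_def mult_ac)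
    also have "14 * K * (p - 1) \<le> 16 * K * p"
      using K p1 by (intro mult_mono) auto
    also have "16 * K * p = 16 * p * K"
      by simp
    also have "16 * p * K \<le> exp (16 * p * K)"
      using exp_ge_add_one_self[of "16 * p * K"] by linarith
    finally show ?thesis by simp
  qed
  finally show ?thesis
    by (simp add: ennreal_leI)
qed

lemma Ap_const_eq_0:
  assumes "Ainf_const v < 1"
  shows "Ap_const p v = 0"
proof -
  have "average (\<lambda>x. ennreal (v x)) I = 0" if "I \<in> bdd_intervals" for I
  proof -
    obtain a b where ab: "a < b" and I: "I \<subseteq> {a..b}" "{a<..<b} \<subseteq> I"
      using \<open>I \<in> bdd_intervals\<close> by (rule bdd_interval_Icc)
    have "emeasure \<mu> {a..b} = 0"
      using one_le_Ainf_const[OF ab] assms by (meson not_le zero_less_iff_neq_zero)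
    then show ?thesis
      by (simp add: average_interval_endpoints[OF I ab] emeasure_\<mu>)
  qed
  then show ?thesis
    unfolding Ap_const_def by (auto intro!: antisym SUP_least)
qed

end

section \<open>Reduction to rational endpoints\<close>

lemma epowr_inverse:
  assumes "0 < r"
  shows "epowr (epowr x r) (1 / r) = x"
proof (cases "x = 0 \<or> x = \<infinity>")
  case True
  then show ?thesis using assms by (auto simp: epowr_def)
next
  case False
  then obtain t where "x = ennreal t" "0 < t"
    by (cases x) (auto simp: less_le)
  then show ?thesis
    using assms by (simp add: epowr_ennreal powr_powr)
qed

text \<open>
  Continuity from below of the power, obtained from the fact that it is an increasing bijection of
  \<open>[0, \<infinity>]\<close>.
\<close>

lemma epowr_SUP_le:
  assumes r: "0 < r" and le: "\<And>k. epowr (Y k) r \<le> B"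
  shows "epowr (SUP k. Y k) r \<le> B"
proof -
  have "Y k \<le> epowr B (1 / r)" for k
    using epowr_mono[OF _ le[of k], of "1 / r"] r by (simp add: epowr_inverse)
  then have "epowr (SUP k. Y k) r \<le> epowr (epowr B (1 / r)) r"
    using r by (intro epowr_mono SUP_least) auto
  also have "\<dots> = B"
    using epowr_inverse[of "1 / r" B] r by simp
  finally show ?thesis .
qed

lemma measurable_epowr[measurable]: "(\<lambda>x. epowr x a) \<in> borel_measurable borel"
  unfolding epowr_def by measurable

lemma decreasing_rationals:
  obtains f :: "nat \<Rightarrow> real" where "decseq f" "f \<longlonglongrightarrow> a" "\<And>n. f n \<in> \<rat>" "\<And>n. a < f n"
proof -
  have "\<exists>f. \<forall>n. (f n \<in> \<rat> \<and> a < f n \<and> f n < a + 1 / real (Suc n)) \<and> f (Suc n) \<le> f n"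
  proof (rule dependent_nat_choice)
    show "\<exists>x. x \<in> \<rat> \<and> a < x \<and> x < a + 1 / real (Suc 0)"
      using Rats_dense_in_real[of a "a + 1"] by auto
    fix x n assume "x \<in> \<rat> \<and> a < x \<and> x < a + 1 / real (Suc n)"
    then have "a < min x (a + 1 / real (Suc (Suc n)))"
      by simp
    from Rats_dense_in_real[OF this]
    show "\<exists>y. (y \<in> \<rat> \<and> a < y \<and> y < a + 1 / real (Suc (Suc n))) \<and> y \<le> x"
      by (auto simp: less_imp_le)
  qed
  then obtain f where f: "\<And>n. f n \<in> \<rat>" "\<And>n. a < f n" "\<And>n. f n < a + 1 / real (Suc n)" "\<And>n. f (Suc n) \<le> f n"
    by metis
  have "(\<lambda>n. a + 1 / real (Suc n)) \<longlonglongrightarrow> a + 0"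
    by (intro tendsto_intros LIMSEQ_Suc[OF lim_1_over_n])
  then have "f \<longlonglongrightarrow> a"
    using f by (intro tendsto_sandwich[of "\<lambda>_. a" f _ "\<lambda>n. a + 1 / real (Suc n)"] always_eventually allI)
       (auto simp: less_imp_le)
  then show thesis
    using that f decseq_SucI by blast
qed

lemma rational_exhaustion:
  assumes "a < (b :: real)"
  shows "\<exists>q r. (\<forall>k. q k \<in> \<rat> \<and> r k \<in> \<rat> \<and> a < q k \<and> r k < b) \<and>
    incseq (\<lambda>k :: nat. {q k..r k}) \<and> (\<Union>k. {q k..r k}) = {a<..<b}"
proof -
  obtain f where f: "decseq f" "f \<longlonglongrightarrow> a" "\<And>n. f n \<in> \<rat>" "\<And>n. a < f n"
    using decreasing_rationals[of a] by metis
  obtain g where g: "decseq g" "g \<longlonglongrightarrow> - b" "\<And>n. g n \<in> \<rat>" "\<And>n. - b < g n"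
    using decreasing_rationals[of "- b"] by metis
  show ?thesis
  proof (rule exI[of _ f], rule exI[of _ "\<lambda>k. - g k"], intro conjI allI)
    show "- g k < b" for k
      using g(4)[of k] by simp
    show "incseq (\<lambda>k. {f k..- g k})"
      using f(1) g(1) by (fastforce simp: incseq_def decseq_def intro: order.trans)
    show "(\<Union>k. {f k..- g k}) = {a<..<b}"
    proof (intro equalityI subsetI)
      fix x assume "x \<in> {a<..<b}"
      then have "eventually (\<lambda>k. f k < x \<and> g k < - x) sequentially"
        using f(2) g(2) by (intro eventually_conj order_tendstoD) auto
      then obtain k where "f k < x" "g k < - x"
        by (auto dest: eventually_happens)
      then show "x \<in> (\<Union>k. {f k..- g k})"
        by (intro UN_I[of k]) auto
    next
      fix x assume "x \<in> (\<Union>k. {f k..- g k})"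
      then obtain k where "f k \<le> x" "x \<le> - g k" by auto
      then show "x \<in> {a<..<b}"
        using f(4)[of k] g(4)[of k] by auto
    qed
  qed (use f g in auto)
qed

text \<open>
  The quantity whose supremum is the \<open>A\<^sub>p\<close> constant, for the closed interval with the given endpoints.
  Taken as a function of a pair, it can be maximised over a countable set of pairs.
\<close>

definition Ap_ratio :: "real \<Rightarrow> (real \<Rightarrow> real) \<Rightarrow> real \<times> real \<Rightarrow> ennreal" where
  "Ap_ratio p v = (\<lambda>(a, b).
     (\<integral>\<^sup>+x\<in>{a..b}. ennreal (v x) \<partial>lebesgue) / ennreal (b - a) *
     epowr ((\<integral>\<^sup>+x\<in>{a..b}. epowr (ennreal (v x)) (- 1 / (p - 1)) \<partial>lebesgue) / ennreal (b - a)) (p - 1))"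

text \<open>
  An interval is exhausted from inside by an increasing sequence of intervals with rational endpoints.
  By monotone convergence the integrals over it are the suprema of those over the smaller intervals,
  even where they are infinite; and dividing by the length of the large interval instead of that of
  the small one only decreases the averages.
\<close>

lemma Ap_const_rational:
  assumes [measurable]: "v \<in> borel_measurable lebesgue" and p: "1 < p"
  shows "Ap_const p v = (SUP J\<in>{(q, r). q \<in> \<rat> \<and> r \<in> \<rat> \<and> q < r}. Ap_ratio p v J)"
    (is "_ = Sup (_ ` ?Q)")
proof (rule antisym)
  let ?B = "SUP J\<in>?Q. Ap_ratio p v J"
  define u where "u x = epowr (ennreal (v x)) (- 1 / (p - 1))" for x
  have [measurable]: "u \<in> borel_measurable lebesgue"
    unfolding u_def by measurable
  have ratio: "average (\<lambda>x. ennreal (v x)) I * epowr (average u I) (p - 1) = Ap_ratio p v (a, b)"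
    if "I \<subseteq> {a..b}" "{a<..<b} \<subseteq> I" "a < b" for I a b
    unfolding average_interval_endpoints[OF that] Ap_ratio_def u_def by simp
  have u_eq: "(\<lambda>x. epowr (ennreal (v x)) (- 1 / (p - 1))) = u"
    by (simp add: u_def fun_eq_iff)
  show "Ap_const p v \<le> ?B"
    unfolding Ap_const_def u_eq
  proof (rule SUP_least)
    fix I assume "I \<in> bdd_intervals"
    then obtain a b where ab: "a < b" and I: "I \<subseteq> {a..b}" "{a<..<b} \<subseteq> I"
      by (rule bdd_interval_Icc)
    obtain q r where qr: "\<forall>k. q k \<in> \<rat> \<and> r k \<in> \<rat> \<and> a < q k \<and> r k < b"
      and inc: "incseq (\<lambda>k :: nat. {q k..r k})" and Un: "(\<Union>k. {q k..r k}) = {a<..<b}"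
      using rational_exhaustion[OF ab] by (elim exE conjE)
    then have rat: "\<And>k. q k \<in> \<rat>" "\<And>k. r k \<in> \<rat>" and in_ab: "\<And>k. a < q k" "\<And>k. r k < b"
      by simp_all
    define A where "A f k = (\<integral>\<^sup>+x\<in>{q k..r k}. f x \<partial>lebesgue) / ennreal (b - a)" for f :: "real \<Rightarrow> ennreal" and k
    have A_inc: "A f k \<le> A f l" if "k \<le> l" for f k l
    proof -
      have "{q k..r k} \<subseteq> {q l..r l}"
        using incseqD[OF inc that] .
      then show ?thesis
        unfolding A_def
        by (intro divide_right_mono_ennreal nn_integral_mono mult_left_mono)
           (auto split: split_indicator simp del: atLeastatMost_subset_iff)
    qed
    have A_SUP: "average f I = (SUP k. A f k)" if [measurable]: "f \<in> borel_measurable lebesgue" for f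
    proof -
      have "average f I = (\<integral>\<^sup>+x\<in>{a<..<b}. f x \<partial>lebesgue) / ennreal (b - a)"
        using set_nn_integral_interval_endpoints[of "{a<..<b}" a b f] greaterThanLessThan_subseteq_greaterThanLessThan
        unfolding average_interval_endpoints[OF I ab] by (auto simp: subset_iff)
      also have "(\<integral>\<^sup>+x\<in>{a<..<b}. f x \<partial>lebesgue) = emeasure (density lebesgue f) (\<Union>k. {q k..r k})"
        unfolding Un by (subst emeasure_density) auto
      also have "\<dots> = (SUP k. emeasure (density lebesgue f) {q k..r k})"
        using inc by (intro SUP_emeasure_incseq[symmetric]) auto
      also have "\<dots> = (SUP k. \<integral>\<^sup>+x\<in>{q k..r k}. f x \<partial>lebesgue)"
        by (subst emeasure_density) auto
      finally show ?thesis
        by (simp add: A_def SUP_divide_ennreal)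
    qed
    have A_le: "A (\<lambda>x. ennreal (v x)) k * epowr (A u l) (p - 1) \<le> ?B" for k l
    proof -
      define n where "n = max k l"
      have "A (\<lambda>x. ennreal (v x)) k * epowr (A u l) (p - 1)
          \<le> A (\<lambda>x. ennreal (v x)) n * epowr (A u n) (p - 1)"
        using p by (intro mult_mono epowr_mono A_inc) (auto simp: n_def)
      also have "\<dots> \<le> ?B"
      proof (cases "q n < r n")
        case True
        have A_le': "A f n \<le> (\<integral>\<^sup>+x\<in>{q n..r n}. f x \<partial>lebesgue) / ennreal (r n - q n)" for f
          unfolding A_def divide_ennreal_def using in_ab[of n] True ab
          by (auto simp: inverse_ennreal intro!: mult_left_mono ennreal_leI le_imp_inverse_le)
        have "A (\<lambda>x. ennreal (v x)) n * epowr (A u n) (p - 1) \<le> Ap_ratio p v (q n, r n)"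
          unfolding Ap_ratio_def prod.case u_def[symmetric]
          using p by (intro mult_mono epowr_mono A_le') auto
        also have "\<dots> \<le> ?B"
          using True rat by (intro SUP_upper) auto
        finally show ?thesis .
      next
        case False
        have "A (\<lambda>x. ennreal (v x)) n = 0"
        proof -
          have "negligible {q n..r n}"
            using False by (intro negligible_subset[OF negligible_sing[of "q n"]]) auto
          then have "(\<integral>\<^sup>+x\<in>{q n..r n}. ennreal (v x) \<partial>lebesgue) = 0"
            by (intro nn_integral_null_set) (simp add: negligible_iff_null_sets)
          then show ?thesis by (simp add: A_def)
        qed
        then show ?thesis by simp
      qed
      finally show ?thesis .
    qed
    have "average (\<lambda>x. ennreal (v x)) I * epowr (average u I) (p - 1)
        = (SUP k. A (\<lambda>x. ennreal (v x)) k * epowr (average u I) (p - 1))"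
    proof -
      have "average (\<lambda>x. ennreal (v x)) I = (SUP k. A (\<lambda>x. ennreal (v x)) k)"
        by (rule A_SUP) measurable
      then show ?thesis
        by (simp only: SUP_mult_right_ennreal)
    qed
    also have "\<dots> \<le> ?B"
    proof (rule SUP_least)
      fix k
      let ?c = "A (\<lambda>x. ennreal (v x)) k"
      have "epowr (SUP l. A u l) (p - 1) \<le> (SUP l. epowr (A u l) (p - 1))"
        using p by (intro epowr_SUP_le SUP_upper) auto
      then have "?c * epowr (average u I) (p - 1) \<le> ?c * (SUP l. epowr (A u l) (p - 1))"
        by (intro mult_left_mono) (auto simp: A_SUP)
      also have "\<dots> = (SUP l. ?c * epowr (A u l) (p - 1))"
        by (simp add: SUP_mult_left_ennreal)
      also have "\<dots> \<le> ?B"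
        by (intro SUP_least A_le)
      finally show "?c * epowr (average u I) (p - 1) \<le> ?B" .
    qed
    finally show "average (\<lambda>x. ennreal (v x)) I * epowr (average u I) (p - 1) \<le> ?B" .
  qed
  show "?B \<le> Ap_const p v"
  proof (rule SUP_least)
    fix J assume "J \<in> ?Q"
    then obtain q r where J: "J = (q, r)" "q < r" by auto
    then have "{q..r} \<in> bdd_intervals"
      by (auto simp: bdd_intervals_def is_interval_cc)
    moreover have "Ap_ratio p v J = average (\<lambda>x. ennreal (v x)) {q..r} * epowr (average u {q..r}) (p - 1)"
      unfolding J(1) using J(2) by (intro ratio[symmetric]) auto
    ultimately show "Ap_ratio p v J \<le> Ap_const p v"
      unfolding Ap_const_def u_eq by (auto intro: SUP_upper)
  qed
qed

section \<open>Slices of weights on product spaces\<close>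

text \<open>
  In a complete measure space a change on a null set preserves measurability.
\<close>

lemma borel_measurable_completion_AE:
  assumes g: "g \<in> borel_measurable M" and ae: "AE x in M. f x = g x"
  shows "f \<in> borel_measurable (completion M)"
proof (rule measurableI)
  fix A :: "'b set" assume A: "A \<in> sets borel"
  show "f -` A \<inter> space (completion M) \<in> sets (completion M)"
  proof (rule completion.in_sets_AE[where A="g -` A \<inter> space M"])
    show "AE x in completion M. x \<in> g -` A \<inter> space M \<longleftrightarrow> x \<in> f -` A \<inter> space (completion M)"
      using AE_completion[OF ae] by eventually_elim auto
    show "g -` A \<inter> space M \<in> sets (completion M)"
      using measurable_sets[OF g A] by (auto intro: sets_completionI_sets)
  qed auto
qed auto

interpretation lborel_prod: product_sigma_finite "\<lambda>_::nat. lborel :: real measure"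
  by standard

text \<open>
  Tonelli's theorem for a null set: almost every line parallel to the \<open>j\<close>-th axis meets it in a null
  set.
\<close>

lemma AE_PiM_insert:
  fixes J :: "nat set"
  assumes J: "finite J" "j \<notin> J" and ae: "AE y in (\<Pi>\<^sub>M i\<in>insert j J. lborel). P y"
  shows "AE x in (\<Pi>\<^sub>M i\<in>J. lborel :: real measure). AE t in lborel. P (x(j := t))"
proof -
  let ?P = "\<Pi>\<^sub>M i\<in>insert j J. lborel :: real measure" and ?Q = "\<Pi>\<^sub>M i\<in>J. lborel :: real measure"
  obtain N where N: "{y \<in> space ?P. \<not> P y} \<subseteq> N" "N \<in> null_sets ?P"
    using ae by (auto simp: eventually_ae_filter)
  have [measurable]: "N \<in> sets ?P"
    using N by auto
  have upd[measurable]: "(\<lambda>(x, t). x(j := t)) \<in> ?Q \<Otimes>\<^sub>M lborel \<rightarrow>\<^sub>M ?P"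
    by (rule measurable_add_dim)
  have "(\<integral>\<^sup>+x. \<integral>\<^sup>+t. indicator N (x(j := t)) \<partial>lborel \<partial>?Q) = (\<integral>\<^sup>+y. indicator N y \<partial>?P)"
    using lborel_prod.product_nn_integral_insert[OF J, of "indicator N"] by simp
  also have "\<dots> = 0"
    using N by auto
  finally have "AE x in ?Q. (\<integral>\<^sup>+t. indicator N (x(j := t)) \<partial>lborel) = 0"
    by (subst (asm) nn_integral_0_iff_AE) measurable
  then show ?thesis
  proof (rule AE_mp[OF _ AE_I2], intro impI)
    fix x assume x: "x \<in> space ?Q" and null: "(\<integral>\<^sup>+t. indicator N (x(j := t)) \<partial>lborel) = 0"
    have [measurable]: "(\<lambda>t. x(j := t)) \<in> lborel \<rightarrow>\<^sub>M ?P"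
      using x by measurable
    have "AE t in lborel. indicator N (x(j := t)) = (0::ennreal)"
      using null by (subst (asm) nn_integral_0_iff_AE) measurable
    then show "AE t in lborel. P (x(j := t))"
    proof eventually_elim
      case (elim t)
      have "x(j := t) \<in> space ?P"
        using x by (auto simp: space_PiM PiE_def extensional_def)
      then show ?case
        using elim N by (auto split: split_indicator_asm)
    qed
  qed
qed

lemma weight_borel_measurable:
  assumes "weight n w"
  shows "w \<in> borel_measurable (lebesgue_PiM {1..n})"
proof (rule borel_measurable_LIMSEQ_real)
  fix k :: nat
  show "(\<lambda>x. indicator (\<Pi>\<^sub>E i\<in>{1..n}. {- real k..real k}) x *\<^sub>R w x) \<in> borel_measurable (lebesgue_PiM {1..n})"
    using assms by (auto simp: weight_def set_integrable_def)
next
  fix x assume "x \<in> space (lebesgue_PiM {1..n})"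
  then have ext: "x \<in> extensional {1..n}"
    by (auto simp: lebesgue_PiM_def space_PiM PiE_def)
  obtain m :: nat where m: "(\<Sum>i\<in>{1..n}. \<bar>x i\<bar>) \<le> real m"
    using real_arch_simple by blast
  have "indicator (\<Pi>\<^sub>E i\<in>{1..n}. {- real k..real k}) x *\<^sub>R w x = w x" if "m \<le> k" for k :: nat
  proof -
    have "x i \<in> {- real k..real k}" if "i \<in> {1..n}" for i
    proof -
      have "\<bar>x i\<bar> \<le> real k"
        using member_le_sum[of i "{1..n}" "\<lambda>i. \<bar>x i\<bar>"] that m \<open>m \<le> k\<close> by force
      then show ?thesis by auto
    qed
    then have "x \<in> (\<Pi>\<^sub>E i\<in>{1..n}. {- real k..real k})"
      using ext by (auto simp only: PiE_def Pi_iff Int_iff)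
    then show ?thesis by simp
  qed
  then have "eventually (\<lambda>k. indicator (\<Pi>\<^sub>E i\<in>{1..n}. {- real k..real k}) x *\<^sub>R w x = w x) sequentially"
    by (auto simp: eventually_sequentially)
  then show "(\<lambda>k. indicator (\<Pi>\<^sub>E i\<in>{1..n}. {- real k..real k}) x *\<^sub>R w x) \<longlonglongrightarrow> w x"
    by (rule tendsto_eventually)
qed

text \<open>
  A weight is only measurable for the completed measure, and so the section theorems for product
  measures do not apply to it. They are applied to a Borel modification \<open>w'\<close>. On almost every line,
  \<open>w\<close> agrees with \<open>w'\<close> almost everywhere and is therefore Lebesgue measurable; it is locally
  integrable by Tonelli's theorem for the cubes \<open>[-k, k]\<^sup>n\<close>, every bounded interval of the line being
  contained in one of them.
\<close>

lemma weight_slices: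
  assumes w: "weight n w" and j: "j \<in> {1..n}"
  obtains w' where "w' \<in> borel_measurable (\<Pi>\<^sub>M i\<in>{1..n}. lborel)"
    "AE x in (\<Pi>\<^sub>M i\<in>{1..n} - {j}. lborel). AE t in lborel. w (x(j := t)) = w' (x(j := t))"
    "AE x in (\<Pi>\<^sub>M i\<in>{1..n} - {j}. lborel). line_weight (\<lambda>t. w (x(j := t)))"
proof -
  define J where "J = {1..n} - {j}"
  have J: "finite J" "j \<notin> J" "insert j J = {1..n}"
    using j by (auto simp: J_def)
  let ?P = "\<Pi>\<^sub>M i\<in>{1..n}. lborel :: real measure" and ?Q = "\<Pi>\<^sub>M i\<in>J. lborel :: real measure"
  have upd[measurable]: "(\<lambda>(x, t). x(j := t)) \<in> ?Q \<Otimes>\<^sub>M lborel \<rightarrow>\<^sub>M ?P"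
    unfolding J(3)[symmetric] by (rule measurable_add_dim)
  have upd_space: "x(j := t) \<in> space ?P" if "x \<in> space ?Q" for x :: "nat \<Rightarrow> real" and t
    using that unfolding J(3)[symmetric] by (auto simp: space_PiM PiE_def extensional_def)
  obtain w' where w'[measurable]: "w' \<in> borel_measurable ?P" and ae: "AE y in ?P. w y = w' y"
    using completion_ex_borel_measurable_real[OF weight_borel_measurable[OF w, unfolded lebesgue_PiM_def]]
    by blast
  have ae1: "AE x in ?Q. AE t in lborel. w (x(j := t)) = w' (x(j := t))"
    using AE_PiM_insert[OF J(1,2), unfolded J(3), OF ae] .
  define C where "C k = (\<Pi>\<^sub>E i\<in>{1..n}. {- real k..real k})" for k :: nat
  have [measurable]: "C k \<in> sets ?P" for k
    unfolding C_def by measurable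
  have ae2: "AE x in ?Q. (\<integral>\<^sup>+t. ennreal (w' (x(j := t))) * indicator (C k) (x(j := t)) \<partial>lborel) \<noteq> \<infinity>" for k
  proof (rule nn_integral_PInf_AE)
    show "(\<lambda>x. \<integral>\<^sup>+t. ennreal (w' (x(j := t))) * indicator (C k) (x(j := t)) \<partial>lborel) \<in> borel_measurable ?Q"
      by measurable
    have "(\<integral>\<^sup>+x. \<integral>\<^sup>+t. ennreal (w' (x(j := t))) * indicator (C k) (x(j := t)) \<partial>lborel \<partial>?Q)
        = (\<integral>\<^sup>+y. ennreal (w' y) * indicator (C k) y \<partial>?P)"
      unfolding J(3)[symmetric]
      by (rule lborel_prod.product_nn_integral_insert[symmetric, OF J(1,2)]) (simp only: J(3), measurable)
    also have "\<dots> = (\<integral>\<^sup>+y. ennreal (w y) * indicator (C k) y \<partial>?P)"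
      using ae by (intro nn_integral_cong_AE, eventually_elim) auto
    also have "\<dots> = (\<integral>\<^sup>+y. ennreal (w y) * indicator (C k) y \<partial>lebesgue_PiM {1..n})"
      unfolding lebesgue_PiM_def by (rule nn_integral_completion[symmetric])
    also have "\<dots> \<le> (\<integral>\<^sup>+y. ennreal (norm (indicator (C k) y *\<^sub>R w y)) \<partial>lebesgue_PiM {1..n})"
      by (intro nn_integral_mono) (auto split: split_indicator intro!: ennreal_leI)
    also have "\<dots> < \<infinity>"
      using w unfolding weight_def set_integrable_def integrable_iff_bounded C_def by simp
    finally show "(\<integral>\<^sup>+x. \<integral>\<^sup>+t. ennreal (w' (x(j := t))) * indicator (C k) (x(j := t)) \<partial>lborel \<partial>?Q) \<noteq> \<infinity>"
      by simp
  qed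
  then have "AE x in ?Q. \<forall>k. (\<integral>\<^sup>+t. ennreal (w' (x(j := t))) * indicator (C k) (x(j := t)) \<partial>lborel) \<noteq> \<infinity>"
    by (simp add: AE_all_countable)
  with ae1 AE_space have "AE x in ?Q. line_weight (\<lambda>t. w (x(j := t)))"
  proof eventually_elim
    case (elim x)
    note x = elim(2) and eq = elim(1) and fin = elim(3)
    have [measurable]: "(\<lambda>t. x(j := t)) \<in> lborel \<rightarrow>\<^sub>M ?P"
      using measurable_compose[OF measurable_Pair1'[OF x] upd] by simp
    show ?case
    proof
      have "(\<lambda>t. w' (x(j := t))) \<in> borel_measurable lebesgue"
        by (intro measurable_completion) measurable
      then show "(\<lambda>t. w (x(j := t))) \<in> borel_measurable lebesgue"
        using eq by (rule_tac borel_measurable_AE) (auto simp: AE_completion_iff eq_commute)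
      show "0 \<le> w (x(j := t))" for t
        using w upd_space[OF x] by (auto simp: weight_def lebesgue_PiM_def)
      fix a b :: real
      obtain k :: nat where k: "(\<Sum>i\<in>J. \<bar>x i\<bar>) + \<bar>a\<bar> + \<bar>b\<bar> \<le> real k"
        using real_arch_simple by blast
      have in_C: "x(j := t) \<in> C k" if t: "t \<in> {a..b}" for t
      proof -
        have "\<bar>x i\<bar> \<le> real k" if "i \<in> J" for i
          using member_le_sum[of i J "\<lambda>i. \<bar>x i\<bar>"] that k J(1) by force
        moreover have "\<bar>t\<bar> \<le> real k"
        proof -
          have "0 \<le> (\<Sum>i\<in>J. \<bar>x i\<bar>)"
            by (intro sum_nonneg) auto
          moreover have "\<bar>t\<bar> \<le> \<bar>a\<bar> + \<bar>b\<bar>"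
            using t by (auto simp: abs_if)
          ultimately show ?thesis
            using k by linarith
        qed
        ultimately have "\<bar>(x(j := t)) i\<bar> \<le> real k" if "i \<in> {1..n}" for i
          using that unfolding J(3)[symmetric] by auto
        then have "(x(j := t)) i \<in> {- real k..real k}" if "i \<in> {1..n}" for i
          using that by (simp only: abs_le_iff atLeastAtMost_iff minus_le_iff[of "real k"])
        then show ?thesis
          using upd_space[OF x, of t] by (auto simp: C_def space_PiM PiE_def)
      qed
      have "(\<integral>\<^sup>+t\<in>{a..b}. ennreal (w (x(j := t))) \<partial>lebesgue)
          = (\<integral>\<^sup>+t\<in>{a..b}. ennreal (w (x(j := t))) \<partial>lborel)"
        by (rule nn_integral_completion)
      also have "\<dots> \<le> (\<integral>\<^sup>+t. ennreal (w' (x(j := t))) * indicator (C k) (x(j := t)) \<partial>lborel)"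
        using eq by (intro nn_integral_mono_AE, eventually_elim) (auto simp: in_C split: split_indicator)
      also have "\<dots> < \<infinity>"
        using fin by (simp add: less_top)
      finally show "(\<integral>\<^sup>+t\<in>{a..b}. ennreal (w (x(j := t))) \<partial>lebesgue) < \<infinity>" .
    qed
  qed
  then show thesis
    using that[OF w'] ae1 unfolding J_def by blast
qed

text \<open>
  For the slices of \<open>w'\<close>, the supremum over rational endpoints is a countable supremum of functions
  that are measurable by Tonelli's theorem. It agrees with the constant of the slice of \<open>w\<close> on almost
  every line, which suffices for the completed measure.
\<close>

lemma Ap_const_slice_measurable:
  assumes w: "weight n w" and j: "j \<in> {1..n}" and p: "1 < p"
  shows "(\<lambda>x. Ap_const p (\<lambda>t. w (x(j := t)))) \<in> borel_measurable (lebesgue_PiM ({1..n} - {j}))"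
proof -
  define J where "J = {1..n} - {j}"
  have J: "finite J" "j \<notin> J" "insert j J = {1..n}"
    using j by (auto simp: J_def)
  let ?P = "\<Pi>\<^sub>M i\<in>{1..n}. lborel :: real measure" and ?Q = "\<Pi>\<^sub>M i\<in>J. lborel :: real measure"
  let ?R = "{(q :: real, r). q \<in> \<rat> \<and> r \<in> \<rat> \<and> q < r}"
  obtain w' where [measurable]: "w' \<in> borel_measurable ?P"
    and eq: "AE x in ?Q. AE t in lborel. w (x(j := t)) = w' (x(j := t))"
    and slice: "AE x in ?Q. line_weight (\<lambda>t. w (x(j := t)))"
    using weight_slices[OF w j] unfolding J_def by blast
  have upd[measurable]: "(\<lambda>(x, t). x(j := t)) \<in> ?Q \<Otimes>\<^sub>M lborel \<rightarrow>\<^sub>M ?P"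
    unfolding J(3)[symmetric] by (rule measurable_add_dim)
  have "countable ?R"
    by (rule countable_subset[of _ "\<rat> \<times> \<rat>"]) (auto simp: countable_rat)
  moreover have "(\<lambda>x. Ap_ratio p (\<lambda>t. w' (x(j := t))) J) \<in> borel_measurable ?Q" for J :: "real \<times> real"
  proof -
    obtain a b where [simp]: "J = (a, b)" by (cases J)
    show ?thesis
      unfolding Ap_ratio_def by (simp add: nn_integral_completion) measurable
  qed
  ultimately have "(\<lambda>x. SUP J\<in>?R. Ap_ratio p (\<lambda>t. w' (x(j := t))) J) \<in> borel_measurable ?Q"
    by (intro borel_measurable_SUP)
  moreover have "AE x in ?Q. Ap_const p (\<lambda>t. w (x(j := t))) = (SUP J\<in>?R. Ap_ratio p (\<lambda>t. w' (x(j := t))) J)"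
    using eq slice
  proof eventually_elim
    case (elim x)
    have ae: "AE t in lebesgue. w (x(j := t)) = w' (x(j := t))"
      using elim(1) by (simp add: AE_completion_iff)
    have "Ap_const p (\<lambda>t. w (x(j := t))) = (SUP J\<in>?R. Ap_ratio p (\<lambda>t. w (x(j := t))) J)"
      using elim(2) by (intro Ap_const_rational p) (auto simp: line_weight_def)
    also have "\<dots> = (SUP J\<in>?R. Ap_ratio p (\<lambda>t. w' (x(j := t))) J)"
    proof (intro SUP_cong refl)
      fix J :: "real \<times> real"
      obtain a b where [simp]: "J = (a, b)" by (cases J)
      have "(\<integral>\<^sup>+t\<in>{a..b}. ennreal (w (x(j := t))) \<partial>lebesgue) = (\<integral>\<^sup>+t\<in>{a..b}. ennreal (w' (x(j := t))) \<partial>lebesgue)"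
        using ae by (intro nn_integral_cong_AE, eventually_elim) auto
      moreover have "(\<integral>\<^sup>+t\<in>{a..b}. epowr (ennreal (w (x(j := t)))) (- 1 / (p - 1)) \<partial>lebesgue)
          = (\<integral>\<^sup>+t\<in>{a..b}. epowr (ennreal (w' (x(j := t)))) (- 1 / (p - 1)) \<partial>lebesgue)"
        using ae by (intro nn_integral_cong_AE, eventually_elim) auto
      ultimately show "Ap_ratio p (\<lambda>t. w (x(j := t))) J = Ap_ratio p (\<lambda>t. w' (x(j := t))) J"
        by (simp add: Ap_ratio_def)
    qed
    finally show ?case .
  qed
  ultimately show ?thesis
    unfolding lebesgue_PiM_def J_def by (intro borel_measurable_completion_AE)
qed

theorem theorem5p2:
  shows "\<exists>c::real. c > 0 \<and>
    (\<forall>n::nat. n \<ge> 1 \<longrightarrow>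
      (\<forall>w \<in> strong_Ainf n. \<forall>p::real.
        p \<ge> exp (c * enn2real (strong_Ainf_const n w)) \<longrightarrow>
          w \<in> strong_Ap p n \<and>
          strong_Ap_const p n w \<le> ennreal (exp (exp (c * p * enn2real (strong_Ainf_const n w))))))"
proof (intro exI[of _ 16] conjI allI impI ballI)
  fix n :: nat and w :: "(nat \<Rightarrow> real) \<Rightarrow> real" and p :: real
  assume "w \<in> strong_Ainf n" and p: "exp (16 * enn2real (strong_Ainf_const n w)) \<le> p"
  then have w: "weight n w" and fin: "strong_Ainf_const n w < \<infinity>"
    by (auto simp: strong_Ainf_def)
  define K where "K = enn2real (strong_Ainf_const n w)"
  have K: "strong_Ainf_const n w = ennreal K" "0 \<le> K"
    using fin by (auto simp: K_def less_top)
  let ?B = "ennreal (exp (exp (16 * p * K)))"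
  have "strong_Ap_const p n w \<le> ?B"
    unfolding strong_Ap_const_def strong_const_def
  proof (rule SUP_least)
    fix j assume j: "j \<in> {1..n}"
    let ?Q = "lebesgue_PiM ({1..n} - {j})"
    have "esssup ?Q (\<lambda>x. Ainf_const (\<lambda>t. w (x(j := t)))) \<le> strong_Ainf_const n w"
      unfolding strong_Ainf_const_def strong_const_def by (rule SUP_upper[OF j])
    then have "esssup ?Q (\<lambda>x. Ainf_const (\<lambda>t. w (x(j := t)))) \<le> ennreal K"
      by (simp add: K)
    then have Ainf: "AE x in ?Q. Ainf_const (\<lambda>t. w (x(j := t))) \<le> ennreal K"
      using esssup_AE by (rule_tac AE_mp[OF esssup_AE]) (auto intro!: AE_I2 intro: order.trans)
    have slice: "AE x in ?Q. line_weight (\<lambda>t. w (x(j := t)))"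
      unfolding lebesgue_PiM_def by (rule weight_slices[OF w j]) (rule AE_completion)
    show "esssup ?Q (\<lambda>x. Ap_const p (\<lambda>t. w (x(j := t)))) \<le> ?B"
    \<comment> \<open>for \<open>K < 1\<close> almost every slice vanishes almost everywhere, and \<open>p = 1\<close> may occur\<close>
    proof (cases "1 \<le> K")
      case True
      show ?thesis
      proof (rule esssup_I)
        have "1 < p"
          using p True by (smt (verit) one_less_exp_iff K_def)
        then show "(\<lambda>x. Ap_const p (\<lambda>t. w (x(j := t)))) \<in> borel_measurable ?Q"
          by (rule Ap_const_slice_measurable[OF w j])
        show "AE x in ?Q. Ap_const p (\<lambda>t. w (x(j := t))) \<le> ?B"
          using Ainf slice
          by eventually_elim (rule line_weight.Ap_const_le, use p True in \<open>auto simp: K_def\<close>)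
      qed
    next
      case False
      then have lt: "ennreal K < 1"
        using K by (simp add: ennreal_less_one_iff)
      from Ainf slice have zero: "AE x in ?Q. Ap_const p (\<lambda>t. w (x(j := t))) = 0"
        by eventually_elim (rule line_weight.Ap_const_eq_0, use lt in \<open>auto intro: le_less_trans\<close>)
      show ?thesis
      proof (rule esssup_I)
        show "(\<lambda>x. Ap_const p (\<lambda>t. w (x(j := t)))) \<in> borel_measurable ?Q"
          using zero[unfolded lebesgue_PiM_def AE_completion_iff] unfolding lebesgue_PiM_def
          by (rule borel_measurable_completion_AE[rotated]) simp
        show "AE x in ?Q. Ap_const p (\<lambda>t. w (x(j := t))) \<le> ?B"
          using zero by eventually_elim simp
      qed
    qed
  qed
  then show "strong_Ap_const p n w \<le> ennreal (exp (exp (16 * p * enn2real (strong_Ainf_const n w))))"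
    by (simp add: K_def)
  then show "w \<in> strong_Ap p n"
    using w by (auto simp: strong_Ap_def intro: le_less_trans)
qed simp

end
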